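(* Let the stepsizes satisfy $\gamma_k\ge 0$, $\sum_{k=0}^\infty\gamma_k=+\infty$, $\sum_{k=0}^\infty\gamma_k^2<+\infty$. Let $c(z,g_i)=f(\|z-g_i\|)$ and assume: (A1) for all $i\in[n]$, $z\mapsto c(z,g_i)$ is lower bounded and lower semi-continuous on $\mathsf Q$, and $z\mapsto\max_{i\in[n]}c(z,g_i)$ is $\mathbb P_z$-integrable; (A2) for all $i\ne j\in[n]$ and all $r\in\mathbb R$, the set $\{z\in\mathsf Q: c(z,g_i)-c(z,g_j)=r\}$ has $\mathbb P_z$-measure zero. Let the weights $w_k=[w_{1,k},\dots,w_{n,k}]\in\mathbb R^n$ be updated by the adaptive partitioning algorithm: $w_{i,0}=0$ for $i\in[n]$ and, for all $k\ge1$ and $i\in[n]$, $$w_{i,k}=\begin{cases} w_{i,k-1}+\gamma_{k-1}(a_i-1) & \text{if } i\in\arg\min_{j\in[n]}\{f(\|Z_k-g_j\|)-w_{j,k-1}\},\\ w_{i,k-1}+\gamma_{k-1}a_i & \text{otherwise.}\end{cases}$$ Then almost surely $w_k$ converges, as $k\to\infty$, to a maximizer $w^*$ over $\mathbb R^n$ of $$h(w)=\int_{\mathsf Q}\min_{i\in[n]}\{c(z,g_i)-w_i\}\,\mathbb P_z(dz)+\sum_{i=1}^n a_iw_i,$$ and the resulting generalized Voronoi diagram $\{V_i^c(\mathcal G,w^* )\}_{i\in[n]}$ satisfies $\mathbb P_z(V_i^c(\mathcal G,w^* ))=a_i$ for all $i\in[n]$.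
   Context: $n,q\ge1$, $[n]=\{1,\dots,n\}$, $\mathsf Q\subset\mathbb R^q$ is compact, and $\mathbb P_z$ is a Borel probability distribution with support included in $\mathsf Q$. The event locations $Z_k$, $k\ge1$, are iid with distribution $\mathbb P_z$. $\mathcal G=\{g_1,\dots,g_n\}$ is a set of $n$ fixed and distinct points of $\mathbb R^q$ (generators). The desired utilization rates satisfy $a_i>0$ for all $i\in[n]$ and $\sum_{i=1}^na_i=1$. The function $f$ is an increasing real-valued function on $\mathbb R_{\ge0}$. For $w\in\mathbb R^n$, the generalized Voronoi cells are $$V_i^c(\mathcal G,w)=\{z\in\mathsf Q: c(z,g_i)-w_i\le c(z,g_j)-w_j,\ \forall j\in[n]\}.$$ (In the robotic implementation, membership in the $\arg\min$ is determined by a distributed minimum-finding procedure, which is assumed to return the correct answer to every robot.) *)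

theory Defs
  imports "HOL-Probability.Probability"
begin

definition measure_support :: "'a::topological_space measure \<Rightarrow> 'a set" where
  "measure_support P = {x. \<forall>U. open U \<and> x \<in> U \<longrightarrow> 0 < emeasure P U}"

(* At a point x isolated in S the filter "at x within S" is trivial,
   so the condition holds vacuously there, as it should. *)
definition lower_semicontinuous_on :: "'a::topological_space set \<Rightarrow> ('a \<Rightarrow> real) \<Rightarrow> bool" where
  "lower_semicontinuous_on S \<phi> \<longleftrightarrow> (\<forall>x\<in>S. \<forall>y<\<phi> x. \<forall>\<^sub>F z in at x within S. y < \<phi> z)"

definition radial_cost :: "(real \<Rightarrow> real) \<Rightarrow> 'a::real_normed_vector \<Rightarrow> 'a \<Rightarrow> real" where
  "radial_cost f z y = f (norm (z - y))"

definition voronoi_cell ::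
  "'a set \<Rightarrow> ('a \<Rightarrow> 'a \<Rightarrow> real) \<Rightarrow> ('n \<Rightarrow> 'a) \<Rightarrow> real^'n \<Rightarrow> 'n::finite \<Rightarrow> 'a set" where
  "voronoi_cell Q c g w i = {z\<in>Q. \<forall>j. c z (g i) - w $ i \<le> c z (g j) - w $ j}"

definition partition_objective ::
  "'a measure \<Rightarrow> 'a set \<Rightarrow> ('a \<Rightarrow> 'a \<Rightarrow> real) \<Rightarrow> ('n \<Rightarrow> 'a) \<Rightarrow> ('n \<Rightarrow> real) \<Rightarrow> real^'n::finite \<Rightarrow> real" where
  "partition_objective P Q c g a w =
     (LINT z:Q|P. (MIN i. c z (g i) - w $ i)) + (\<Sum>i\<in>UNIV. a i * w $ i)"

end

theory Submission
  imports Defs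
begin

text \<open>
  The weight update is a stochastic supergradient ascent for the objective \<open>h\<close>. At weights
  \<open>w\<close>, the vector \<open>direction w z\<close> with components \<open>a i\<close> minus the indicator of the cell of \<open>i\<close>
  is what the algorithm adds (times the step) on observing \<open>z\<close>. Since ties have measure zero,
  its mean is a supergradient of \<open>h\<close> at \<open>w\<close> (lemma \<open>supergradient\<close>). Costs on \<open>Q\<close> are bounded
  below, the largest is integrable, and \<open>h\<close> does not change when a constant is added to all
  weights, so \<open>h\<close> attains its maximum (\<open>ex_maximizer\<close>), and at any maximizer the cells have
  the prescribed masses (\<open>prob_cell_maximizer\<close>).

  For convergence, fix a maximizer \<open>u\<close> and expand the squared distance of the iterate to \<open>u\<close>.
  Each step contributes a drift, which is at most minus twice the step times the optimality
  gap, a martingale difference, and a quadratic term of the size of the squared step. Taking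
  expectations, the drift can be dropped, so the mean squared distance stays bounded; hence
  the martingale differences have summable second moments and their series converges almost
  surely (\<open>AE_summable\<close>). Reading the same expansion pathwise, the total drift must then be
  finite as well. Thus almost surely the distance to \<open>u\<close> converges and the sum of the
  optimality gaps weighted by the steps is finite (\<open>distance_converges_if_noise_summable\<close>).

  As the sum of the steps diverges, the gaps come arbitrarily close to zero, so a subsequence
  tends to a maximizer. The maximizer need not be unique, and the limit may be random; but the
  distances to all points of a countable dense set of maximizers converge simultaneously with
  probability one, and this forces the whole sequence to converge to the limit of the
  subsequence (\<open>converges_if_distances_converge\<close>).
\<close>

section \<open>Series of bounded martingale differences\<close>

text \<open>
  The partial sums of \<open>d\<close>, frozen from the first time their modulus reaches \<open>e\<close>. Freezing
  turns a statement about the maximum of the partial sums into one about a single value, so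
  that Markov's inequality applies.
\<close>

primrec stopped_sum :: "real \<Rightarrow> (nat \<Rightarrow> real) \<Rightarrow> nat \<Rightarrow> real" where
  "stopped_sum e d 0 = 0"
| "stopped_sum e d (Suc n) =
     stopped_sum e d n + (if \<bar>stopped_sum e d n\<bar> < e then d n else 0)"

lemma stopped_sum_ge_mono:
  assumes "k \<le> n" "e \<le> \<bar>stopped_sum e d k\<bar>"
  shows "e \<le> \<bar>stopped_sum e d n\<bar>"
  using assms by (induction n rule: dec_induct) auto

lemma stopped_sum_eq_sum_or_stopped:
  "stopped_sum e d n = (\<Sum>i<n. d i) \<or> e \<le> \<bar>stopped_sum e d n\<bar>"
  by (induction n) auto

lemma stopped_sum_ge:
  assumes "k \<le> n" "e \<le> \<bar>\<Sum>i<k. d i\<bar>"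
  shows "e \<le> \<bar>stopped_sum e d n\<bar>"
  using stopped_sum_ge_mono[OF assms(1)] stopped_sum_eq_sum_or_stopped[of e d k] assms(2) by auto

lemma abs_stopped_sum_le:
  "\<bar>stopped_sum e d n\<bar> \<le> (\<Sum>i<n. \<bar>d i\<bar>)"
  by (induction n) auto

text \<open>
  Martingale differences are described by orthogonality to every bounded function of the past
  rather than by a vanishing conditional expectation: in this form independence delivers the
  property, and in this form it kills the cross terms of second moments. Boundedness of each
  single term (not uniformly in \<open>k\<close>) makes all integrability questions trivial.
\<close>

locale bounded_martingale_differences = prob_space M
  for M :: "'b measure" +
  fixes F :: "nat \<Rightarrow> 'b measure" and D :: "nat \<Rightarrow> 'b \<Rightarrow> real" and B :: "nat \<Rightarrow> real"
  assumes subalg: "subalgebra M (F k)"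
    and filtration: "subalgebra (F (Suc k)) (F k)"
    and adapted: "D k \<in> borel_measurable (F (Suc k))"
    and bounded: "\<omega> \<in> space M \<Longrightarrow> \<bar>D k \<omega>\<bar> \<le> B k"
    and orthogonal: "X \<in> borel_measurable (F k) \<Longrightarrow> (\<And>\<omega>. \<omega> \<in> space M \<Longrightarrow> \<bar>X \<omega>\<bar> \<le> C)
      \<Longrightarrow> expectation (\<lambda>\<omega>. X \<omega> * D k \<omega>) = 0"
begin

lemma measurable_D [measurable]: "D k \<in> borel_measurable M"
  using measurable_from_subalg[OF subalg adapted] .

lemma integrable_bounded_fun:
  fixes X :: "'b \<Rightarrow> real"
  assumes "X \<in> borel_measurable M" "\<And>\<omega>. \<omega> \<in> space M \<Longrightarrow> \<bar>X \<omega>\<bar> \<le> C"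
  shows "integrable M X"
  by (rule integrable_const_bound[of _ C]) (use assms in auto)

lemma integrable_bounded_power2:
  fixes X :: "'b \<Rightarrow> real"
  assumes "X \<in> borel_measurable M" "\<And>\<omega>. \<omega> \<in> space M \<Longrightarrow> \<bar>X \<omega>\<bar> \<le> C"
  shows "integrable M (\<lambda>\<omega>. (X \<omega>)\<^sup>2)"
proof (rule integrable_bounded_fun)
  show "\<bar>(X \<omega>)\<^sup>2\<bar> \<le> C\<^sup>2" if "\<omega> \<in> space M" for \<omega>
    using power_mono[OF assms(2)[OF that], of 2] by simp
qed (use assms in measurable)

lemma measurable_stopped_sum:
  "(\<lambda>\<omega>. stopped_sum e (\<lambda>i. D (m + i) \<omega>) n) \<in> borel_measurable (F (m + n))"
proof (induction n)
  case (Suc n)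
  have [measurable]: "(\<lambda>\<omega>. stopped_sum e (\<lambda>i. D (m + i) \<omega>) n) \<in> borel_measurable (F (m + Suc n))"
    using measurable_from_subalg[OF filtration Suc] by simp
  have [measurable]: "D (m + n) \<in> borel_measurable (F (m + Suc n))"
    using adapted[of "m + n"] by simp
  show ?case unfolding stopped_sum.simps by measurable
qed simp

text \<open>
  Whether the stopped sum moves at stage \<open>n\<close>, and its current value, are both functions of the
  past. Hence the cross term in the square of the next value has expectation zero, and each
  stage adds at most the second moment of its difference.
\<close>

lemma second_moment_stopped_sum:
  "expectation (\<lambda>\<omega>. (stopped_sum e (\<lambda>i. D (m + i) \<omega>) n)\<^sup>2)
    \<le> (\<Sum>i<n. expectation (\<lambda>\<omega>. (D (m + i) \<omega>)\<^sup>2))"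
proof (induction n)
  case (Suc n)
  define S where "S \<omega> = stopped_sum e (\<lambda>i. D (m + i) \<omega>) n" for \<omega>
  \<comment> \<open>\<open>Y\<close> indicates that the sum has not been stopped yet.\<close>
  define Y where "Y \<omega> = (if \<bar>S \<omega>\<bar> < e then 1 else 0 :: real)" for \<omega>
  define C where "C = (\<Sum>i<n. B (m + i))"
  have SF [measurable]: "S \<in> borel_measurable (F (m + n))"
    unfolding S_def by (rule measurable_stopped_sum)
  have SM [measurable]: "S \<in> borel_measurable M"
    by (rule measurable_from_subalg[OF subalg SF])
  have YM [measurable]: "Y \<in> borel_measurable M" unfolding Y_def by measurable
  have S_le: "\<bar>S \<omega>\<bar> \<le> C" if "\<omega> \<in> space M" for \<omega>
    unfolding S_def C_def
    by (rule order.trans[OF abs_stopped_sum_le]) (intro sum_mono bounded that)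
  have S2: "integrable M (\<lambda>\<omega>. (S \<omega>)\<^sup>2)"
    by (rule integrable_bounded_power2) (use S_le in auto)
  have D2: "integrable M (\<lambda>\<omega>. (D (m + n) \<omega>)\<^sup>2)"
    by (rule integrable_bounded_power2) (use bounded in auto)
  have YD: "integrable M (\<lambda>\<omega>. Y \<omega> * (D (m + n) \<omega>)\<^sup>2)"
    by (rule Bochner_Integration.integrable_bound[OF D2]) (auto simp: Y_def)
  have YSD: "integrable M (\<lambda>\<omega>. (Y \<omega> * S \<omega>) * D (m + n) \<omega>)"
  proof (rule integrable_bounded_fun[of _ "C * B (m + n)"])
    fix \<omega> assume w: "\<omega> \<in> space M"
    have "\<bar>Y \<omega> * S \<omega>\<bar> \<le> C" using S_le[OF w] by (auto simp: Y_def)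
    then show "\<bar>Y \<omega> * S \<omega> * D (m + n) \<omega>\<bar> \<le> C * B (m + n)"
      unfolding abs_mult[of "Y \<omega> * S \<omega>"] by (intro mult_mono bounded w) (auto)
  qed simp
  have "expectation (\<lambda>\<omega>. (stopped_sum e (\<lambda>i. D (m + i) \<omega>) (Suc n))\<^sup>2)
    = expectation (\<lambda>\<omega>. ((S \<omega>)\<^sup>2 + 2 * (Y \<omega> * S \<omega> * D (m + n) \<omega>)) + Y \<omega> * (D (m + n) \<omega>)\<^sup>2)"
  proof (intro Bochner_Integration.integral_cong refl)
    fix \<omega>
    have "stopped_sum e (\<lambda>i. D (m + i) \<omega>) (Suc n) = S \<omega> + Y \<omega> * D (m + n) \<omega>"
      by (simp add: S_def Y_def)
    moreover have "(Y \<omega>)\<^sup>2 = Y \<omega>" by (simp add: Y_def)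
    ultimately show "(stopped_sum e (\<lambda>i. D (m + i) \<omega>) (Suc n))\<^sup>2
        = ((S \<omega>)\<^sup>2 + 2 * (Y \<omega> * S \<omega> * D (m + n) \<omega>)) + Y \<omega> * (D (m + n) \<omega>)\<^sup>2"
      by (simp add: power2_sum power_mult_distrib mult_ac)
  qed
  also have "\<dots> = expectation (\<lambda>\<omega>. (S \<omega>)\<^sup>2)
      + 2 * expectation (\<lambda>\<omega>. Y \<omega> * S \<omega> * D (m + n) \<omega>)
      + expectation (\<lambda>\<omega>. Y \<omega> * (D (m + n) \<omega>)\<^sup>2)"
    using S2 YD YSD by simp
  also have "expectation (\<lambda>\<omega>. Y \<omega> * S \<omega> * D (m + n) \<omega>) = 0"
  proof (rule orthogonal[where C = C])
    show "(\<lambda>\<omega>. Y \<omega> * S \<omega>) \<in> borel_measurable (F (m + n))" unfolding Y_def by measurable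
  qed (use S_le in \<open>auto simp: Y_def intro: order.trans[OF abs_ge_zero]\<close>)
  also have "expectation (\<lambda>\<omega>. Y \<omega> * (D (m + n) \<omega>)\<^sup>2) \<le> expectation (\<lambda>\<omega>. (D (m + n) \<omega>)\<^sup>2)"
    by (rule integral_mono[OF YD D2]) (auto simp: Y_def)
  finally show ?case using Suc by (simp add: S_def)
qed simp

text \<open>
  Kolmogorov's maximal inequality: if some partial sum reaches \<open>e\<close>, then so does the stopped
  sum at the final time.
\<close>

lemma maximal_inequality:
  assumes e: "0 < e"
  shows "prob {\<omega>\<in>space M. \<exists>k\<le>n. e \<le> \<bar>\<Sum>i<k. D (m + i) \<omega>\<bar>}
    \<le> (\<Sum>i<n. expectation (\<lambda>\<omega>. (D (m + i) \<omega>)\<^sup>2)) / e\<^sup>2"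
proof -
  define S where "S \<omega> = stopped_sum e (\<lambda>i. D (m + i) \<omega>) n" for \<omega>
  have [measurable]: "S \<in> borel_measurable M"
    unfolding S_def by (rule measurable_from_subalg[OF subalg measurable_stopped_sum])
  have S_le: "\<bar>S \<omega>\<bar> \<le> (\<Sum>i<n. B (m + i))" if "\<omega> \<in> space M" for \<omega>
    unfolding S_def by (rule order.trans[OF abs_stopped_sum_le]) (intro sum_mono bounded that)
  have S2: "integrable M (\<lambda>\<omega>. (S \<omega>)\<^sup>2)"
    by (rule integrable_bounded_power2) (use S_le in auto)
  have "prob {\<omega>\<in>space M. \<exists>k\<le>n. e \<le> \<bar>\<Sum>i<k. D (m + i) \<omega>\<bar>} \<le> prob {\<omega>\<in>space M. e\<^sup>2 \<le> (S \<omega>)\<^sup>2}"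
  proof (rule finite_measure_mono, safe)
    fix \<omega> k assume "k \<le> n" "e \<le> \<bar>\<Sum>i<k. D (m + i) \<omega>\<bar>"
    then have "e \<le> \<bar>S \<omega>\<bar>" unfolding S_def by (rule stopped_sum_ge)
    then show "e\<^sup>2 \<le> (S \<omega>)\<^sup>2" using e by (metis less_imp_le power2_abs power_mono)
  qed simp
  also have "\<dots> \<le> expectation (\<lambda>\<omega>. (S \<omega>)\<^sup>2) / e\<^sup>2"
    using e by (intro integral_Markov_inequality_measure[OF S2, where A = "{}"]) auto
  also have "\<dots> \<le> (\<Sum>i<n. expectation (\<lambda>\<omega>. (D (m + i) \<omega>)\<^sup>2)) / e\<^sup>2"
    unfolding S_def by (intro divide_right_mono second_moment_stopped_sum) simp
  finally show ?thesis .
qed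

text \<open>
  Letting the horizon \<open>n\<close> tend to infinity in the maximal inequality bounds the probability
  that the sums started at \<open>m\<close> ever reach \<open>e\<close> by a tail of a convergent series.
\<close>

lemma AE_tail_small:
  assumes e: "0 < e" and sq: "summable (\<lambda>k. expectation (\<lambda>\<omega>. (D k \<omega>)\<^sup>2))"
  shows "AE \<omega> in M. \<exists>m. \<forall>k. \<bar>\<Sum>i<k. D (m + i) \<omega>\<bar> < e"
proof -
  define b where "b k = expectation (\<lambda>\<omega>. (D k \<omega>)\<^sup>2)" for k
  have b0: "0 \<le> b k" for k unfolding b_def by simp
  have sb: "summable b" using sq unfolding b_def .
  define A where "A m n = {\<omega>\<in>space M. \<exists>k\<le>n. e \<le> \<bar>\<Sum>i<k. D (m + i) \<omega>\<bar>}" for m n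
  have A [measurable]: "A m n \<in> sets M" for m n unfolding A_def by measurable
  define R where "R m = (\<Union>n. A m n)" for m
  have R [measurable]: "R m \<in> sets M" for m unfolding R_def by measurable
  have prob_R: "prob (R m) \<le> (\<Sum>i. b (i + m)) / e\<^sup>2" for m
  proof (rule LIMSEQ_le_const2)
    show "(\<lambda>n. prob (A m n)) \<longlonglongrightarrow> prob (R m)"
      unfolding R_def
      by (intro finite_Lim_measure_incseq) (auto simp: A_def incseq_def intro: order.trans)
    have "prob (A m n) \<le> (\<Sum>i. b (i + m)) / e\<^sup>2" for n
    proof -
      have "(\<Sum>i<n. b (m + i)) \<le> (\<Sum>i. b (i + m))"
        using sum_le_suminf[OF summable_ignore_initial_segment[OF sb, of m], of "{..<n}"] b0
        by (simp add: add.commute)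
      then show ?thesis
        using maximal_inequality[OF e, of n m] unfolding A_def b_def
        by (meson divide_right_mono order.trans zero_le_power2)
    qed
    then show "\<exists>N. \<forall>n\<ge>N. prob (A m n) \<le> (\<Sum>i. b (i + m)) / e\<^sup>2" by auto
  qed
  have "prob (\<Inter>m. R m) \<le> \<delta>" if "0 < \<delta>" for \<delta>
  proof -
    have "0 < \<delta> * e\<^sup>2" using that e by simp
    from suminf_exist_split[OF this sb]
    obtain m where m: "norm (\<Sum>i. b (i + m)) < \<delta> * e\<^sup>2" by blast
    have "prob (\<Inter>m. R m) \<le> prob (R m)" by (intro finite_measure_mono) auto
    also have "\<dots> \<le> (\<Sum>i. b (i + m)) / e\<^sup>2" by (rule prob_R)
    also have "\<dots> \<le> \<delta>" using m e by (simp add: field_simps)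
    finally show ?thesis .
  qed
  then have "prob (\<Inter>m. R m) = 0"
    by (metis dual_order.antisym field_le_epsilon measure_nonneg add_0)
  then have "AE \<omega> in M. \<omega> \<notin> (\<Inter>m. R m)"
    by (intro AE_not_in) (simp add: emeasure_eq_measure null_sets_def)
  then show ?thesis
  proof (rule AE_mp, intro AE_I2 impI)
    fix \<omega> assume \<omega>: "\<omega> \<in> space M" "\<omega> \<notin> (\<Inter>m. R m)"
    then obtain m where "\<omega> \<notin> R m" by blast
    then have "\<omega> \<notin> A m k" for k by (auto simp: R_def)
    then have "\<not> e \<le> \<bar>\<Sum>i<k. D (m + i) \<omega>\<bar>" for k
      using \<omega>(1) unfolding A_def by blast
    then have "\<bar>\<Sum>i<k. D (m + i) \<omega>\<bar> < e" for k by (simp only: not_le)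
    then show "\<exists>m. \<forall>k. \<bar>\<Sum>i<k. D (m + i) \<omega>\<bar> < e" by blast
  qed
qed

theorem AE_summable:
  assumes sq: "summable (\<lambda>k. expectation (\<lambda>\<omega>. (D k \<omega>)\<^sup>2))"
  shows "AE \<omega> in M. summable (\<lambda>k. D k \<omega>)"
proof -
  have "AE \<omega> in M. \<forall>N::nat. \<exists>m. \<forall>k. \<bar>\<Sum>i<k. D (m + i) \<omega>\<bar> < inverse (of_nat (Suc N))"
    unfolding AE_all_countable by (intro allI AE_tail_small sq) simp
  then show ?thesis
  proof (rule AE_mp, intro AE_I2 impI)
    fix \<omega> assume *: "\<forall>N::nat. \<exists>m. \<forall>k. \<bar>\<Sum>i<k. D (m + i) \<omega>\<bar> < inverse (of_nat (Suc N))"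
    show "summable (\<lambda>k. D k \<omega>)" unfolding summable_Cauchy
    proof (intro allI impI)
      fix e :: real assume e: "0 < e"
      obtain N where N: "inverse (of_nat (Suc N)) < e / 2"
        using reals_Archimedean[of "e/2"] e by auto
      obtain m where m: "\<bar>\<Sum>i<k. D (m + i) \<omega>\<bar> < e / 2" for k
        using * N by (meson less_trans)
      have "norm (\<Sum>i\<in>{p..<q}. D i \<omega>) < e" if p: "m \<le> p" for p q
      proof (cases "p \<le> q")
        case True
        have 1: "(\<Sum>i\<in>{m..<m + k}. D i \<omega>) = (\<Sum>i<k. D (m + i) \<omega>)" for k
          using sum.shift_bounds_nat_ivl[of "\<lambda>i. D i \<omega>" 0 m k]
          by (simp add: add.commute atLeast0LessThan)
        have "(\<Sum>i\<in>{m..<p}. D i \<omega>) + (\<Sum>i\<in>{p..<q}. D i \<omega>) = (\<Sum>i\<in>{m..<q}. D i \<omega>)"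
          by (rule sum.atLeastLessThan_concat[OF p True])
        then show ?thesis using m[of "p - m"] m[of "q - m"] 1[of "p - m"] 1[of "q - m"] p True
          by auto
      qed (use e in simp)
      then show "\<exists>N. \<forall>m\<ge>N. \<forall>n. norm (\<Sum>i\<in>{m..<n}. D i \<omega>) < e" by blast
    qed
  qed
qed

end

section \<open>Averaging over a sample independent of the past\<close>

context prob_space
begin

text \<open>
  The sigma-algebra generated by the first \<open>k\<close> samples, as the pullback along the whole
  initial segment. This makes its independence of the next sample an instance of the
  independence of disjoint blocks of an independent family.
\<close>

definition past :: "'b measure \<Rightarrow> (nat \<Rightarrow> 'a \<Rightarrow> 'b) \<Rightarrow> nat \<Rightarrow> 'a measure" where
  "past N Y k = vimage_algebra (space M) (\<lambda>\<omega>. \<lambda>i\<in>{..<k}. Y i \<omega>) (PiM {..<k} (\<lambda>_. N))"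

lemma space_past [simp]: "space (past N Y k) = space M"
  by (simp add: past_def)

lemma measurable_past:
  assumes Y: "\<And>i. Y i \<in> measurable M N" and i: "i < k"
  shows "Y i \<in> measurable (past N Y k) N"
proof -
  have "(\<lambda>\<omega>. \<lambda>i\<in>{..<k}. Y i \<omega>) \<in> measurable (past N Y k) (PiM {..<k} (\<lambda>_. N))"
    unfolding past_def
    by (rule measurable_vimage_algebra1) (use measurable_space[OF Y] in \<open>auto simp: space_PiM\<close>)
  from measurable_compose[OF this measurable_component_singleton[of i]]
  show ?thesis using i by simp
qed

lemma subalgebra_past:
  assumes Y: "\<And>i. Y i \<in> measurable M N"
  shows "subalgebra M (past N Y k)"
proof -
  have "(\<lambda>\<omega>. \<omega>) \<in> measurable M (past N Y k)"
    unfolding past_def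
    by (rule measurable_vimage_algebra2) (auto intro!: measurable_restrict Y)
  from measurable_sets[OF this] show ?thesis
    unfolding subalgebra_def using sets.sets_into_space[of _ "past N Y k"]
    by (auto simp: Int_absorb2)
qed

lemma subalgebra_past_Suc:
  assumes Y: "\<And>i. Y i \<in> measurable M N"
  shows "subalgebra (past N Y (Suc k)) (past N Y k)"
proof -
  have "(\<lambda>\<omega>. \<omega>) \<in> measurable (past N Y (Suc k)) (past N Y k)"
    unfolding past_def[of N Y k]
    by (rule measurable_vimage_algebra2) (auto intro!: measurable_restrict measurable_past Y)
  from measurable_sets[OF this] show ?thesis
    unfolding subalgebra_def using sets.sets_into_space[of _ "past N Y k"]
    by (auto simp: Int_absorb2)
qed

text \<open>
  The two variables may have different types, so independence is expressed by the joint law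
  being a product measure.
\<close>

lemma joint_distr_past:
  assumes ind: "indep_vars (\<lambda>_. N) Y UNIV" and distr: "distr M N (Y k) = N"
    and X: "X \<in> measurable (past N Y k) S"
  shows "distr M (S \<Otimes>\<^sub>M N) (\<lambda>\<omega>. (X \<omega>, Y k \<omega>)) = distr M S X \<Otimes>\<^sub>M N"
proof -
  have Y [measurable]: "Y i \<in> measurable M N" for i using ind by (simp add: indep_vars_def)
  have X_M [measurable]: "X \<in> measurable M S"
    by (rule measurable_from_subalg[OF subalgebra_past[OF Y] X])
  interpret N: prob_space N using prob_space_distr[OF Y, of k] distr by simp
  interpret X: prob_space "distr M S X" by (rule prob_space_distr) simp
  let ?H = "\<lambda>\<omega>. \<lambda>i\<in>{..<k}. Y i \<omega>" and ?K = "\<lambda>\<omega>. \<lambda>i\<in>{k}. Y i \<omega>"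
  have indep: "indep_var (PiM {..<k} (\<lambda>_. N)) ?H (PiM {k} (\<lambda>_. N)) ?K"
    by (rule indep_var_restrict[OF ind]) auto
  show ?thesis
  proof (rule pair_measure_eqI[symmetric])
    fix A B assume "A \<in> sets (distr M S X)" and B: "B \<in> sets N"
    then have A: "A \<in> sets S" by simp
    have H: "?H \<in> space M \<rightarrow> space (PiM {..<k} (\<lambda>_. N))"
      using measurable_space[OF Y] by (auto simp: space_PiM)
    from measurable_sets[OF X A] obtain A' where A': "A' \<in> sets (PiM {..<k} (\<lambda>_. N))"
      "X -` A \<inter> space M = ?H -` A' \<inter> space M"
      unfolding past_def sets_vimage_algebra2[OF H] by auto
    define B' where "B' = (\<lambda>x. x k) -` B \<inter> space (PiM {k} (\<lambda>_. N))"
    have B': "B' \<in> sets (PiM {k} (\<lambda>_. N))"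
      unfolding B'_def by (rule measurable_sets[OF _ B]) simp
    have YB: "Y k -` B \<inter> space M = ?K -` B' \<inter> space M"
      using measurable_space[OF Y] by (auto simp: B'_def space_PiM)
    have "prob (X -` A \<inter> space M \<inter> (Y k -` B \<inter> space M))
        = prob (X -` A \<inter> space M) * prob (Y k -` B \<inter> space M)"
      using indep_varD[OF indep A'(1) B'] unfolding A'(2) YB
      by (simp add: vimage_Times Int_ac) (simp add: vimage_def Int_ac)
    moreover have "emeasure N B = prob (Y k -` B \<inter> space M)"
      using B by (subst distr[symmetric]) (simp add: emeasure_distr emeasure_eq_measure)
    moreover have "emeasure (distr M S X) A = prob (X -` A \<inter> space M)"
      using A by (simp add: emeasure_distr emeasure_eq_measure)
    moreover have "emeasure (distr M (S \<Otimes>\<^sub>M N) (\<lambda>\<omega>. (X \<omega>, Y k \<omega>))) (A \<times> B)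
        = prob (X -` A \<inter> space M \<inter> (Y k -` B \<inter> space M))"
      using A B by (subst emeasure_distr)
        (auto simp: emeasure_eq_measure intro!: arg_cong[where f = prob])
    ultimately show "emeasure (distr M S X) A * emeasure N B
        = emeasure (distr M (S \<Otimes>\<^sub>M N) (\<lambda>\<omega>. (X \<omega>, Y k \<omega>))) (A \<times> B)"
      by (simp add: ennreal_mult'')
  qed (auto intro: X.sigma_finite_measure N.sigma_finite_measure)
qed

text \<open>
  A variable \<open>X\<close> determined by the past may be held fixed while the new sample is averaged
  out. This takes the place of a conditional expectation given the past; it is Fubini for the
  product law.
\<close>

lemma expectation_freeze_past:
  fixes \<psi> :: "'c \<Rightarrow> 'b \<Rightarrow> real"
  assumes ind: "indep_vars (\<lambda>_. N) Y UNIV" and distr: "distr M N (Y k) = N"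
    and X: "X \<in> measurable (past N Y k) S"
    and meas: "(\<lambda>(x, y). \<psi> x y) \<in> borel_measurable (S \<Otimes>\<^sub>M N)"
    and int: "integrable M (\<lambda>\<omega>. \<psi> (X \<omega>) (Y k \<omega>))"
  shows "expectation (\<lambda>\<omega>. \<psi> (X \<omega>) (Y k \<omega>)) = expectation (\<lambda>\<omega>. \<integral>y. \<psi> (X \<omega>) y \<partial>N)"
proof -
  have Y [measurable]: "Y i \<in> measurable M N" for i using ind by (simp add: indep_vars_def)
  have [measurable]: "X \<in> measurable M S" by (rule measurable_from_subalg[OF subalgebra_past[OF Y] X])
  have N: "prob_space N" using prob_space_distr[OF Y, of k] distr by simp
  interpret N: prob_space N by fact
  interpret X: prob_space "distr M S X" by (rule prob_space_distr) simp
  interpret pair_sigma_finite "distr M S X" N ..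
  note meas [measurable]
  have joint: "distr M (S \<Otimes>\<^sub>M N) (\<lambda>\<omega>. (X \<omega>, Y k \<omega>)) = distr M S X \<Otimes>\<^sub>M N"
    by (rule joint_distr_past[OF ind distr X])
  have int': "integrable (distr M S X \<Otimes>\<^sub>M N) (\<lambda>(x, y). \<psi> x y)"
    unfolding joint[symmetric] using int by (subst integrable_distr_eq) auto
  have "expectation (\<lambda>\<omega>. \<psi> (X \<omega>) (Y k \<omega>)) = (\<integral>p. (\<lambda>(x, y). \<psi> x y) p \<partial>(distr M S X \<Otimes>\<^sub>M N))"
    unfolding joint[symmetric] by (subst integral_distr) auto
  also have "\<dots> = (\<integral>x. (\<integral>y. \<psi> x y \<partial>N) \<partial>distr M S X)"
    using integral_fst'[OF int'] by simp
  also have "\<dots> = expectation (\<lambda>\<omega>. \<integral>y. \<psi> (X \<omega>) y \<partial>N)"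
    by (subst integral_distr) auto
  finally show ?thesis .
qed

end

section \<open>The dual objective and its maximizers\<close>

text \<open>
  The dual of a semi-discrete transport problem on a probability space \<open>P\<close>: \<open>c i z\<close> is the
  cost of serving the location \<open>z\<close> from generator \<open>i\<close>, and \<open>a\<close> prescribes the masses of the
  cells. The absence of ties makes the cells a partition up to a null set.
\<close>

locale semidiscrete_dual = prob_space P
  for P :: "'z measure" +
  fixes c :: "'n::finite \<Rightarrow> 'z \<Rightarrow> real" and a :: "real^'n"
  assumes integrable_cost: "integrable P (c i)"
    and no_ties: "i \<noteq> j \<Longrightarrow> AE z in P. c i z - c j z \<noteq> r"
    and weight_pos: "0 < a $ i"
    and weight_sum: "(\<Sum>i\<in>UNIV. a $ i) = 1"
begin

definition cell :: "real^'n \<Rightarrow> 'n \<Rightarrow> 'z set" where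
  "cell w i = {z \<in> space P. \<forall>j. c i z - w $ i \<le> c j z - w $ j}"

definition objective :: "real^'n \<Rightarrow> real" where
  "objective w = (\<integral>z. (MIN i. c i z - w $ i) \<partial>P) + a \<bullet> w"

text \<open>
  A stochastic supergradient of the objective at \<open>w\<close>, observed at the location \<open>z\<close>, and its
  mean.
\<close>

definition direction :: "real^'n \<Rightarrow> 'z \<Rightarrow> real^'n" where
  "direction w z = (\<chi> i. a $ i - indicat_real (cell w i) z)"

definition mean_direction :: "real^'n \<Rightarrow> real^'n" where
  "mean_direction w = (\<chi> i. a $ i - prob (cell w i))"

lemma measurable_cost [measurable]: "c i \<in> borel_measurable P"
  using integrable_cost[of i] by simp

lemma cell_sets [measurable]: "cell w i \<in> sets P"
  unfolding cell_def by measurable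

lemma weight_le_1: "a $ i \<le> 1"
  using member_le_sum[of i UNIV "\<lambda>i. a $ i"] weight_pos weight_sum by (simp add: less_imp_le)

lemma min_le: "(MIN i. c i z - w $ i) \<le> c j z - w $ j"
  by (intro Min_le) auto

lemma min_eq_on_cell: "z \<in> cell w j \<Longrightarrow> (MIN i. c i z - w $ i) = c j z - w $ j"
  by (intro Min_eqI) (auto simp: cell_def)

lemma ex_cell:
  assumes "z \<in> space P" shows "\<exists>i. z \<in> cell w i"
proof -
  have "(MIN i. c i z - w $ i) \<in> range (\<lambda>i. c i z - w $ i)" by (intro Min_in) auto
  then obtain i where "(MIN i. c i z - w $ i) = c i z - w $ i" by (rule rangeE)
  then have "z \<in> cell w i" using min_le[of z w] assms by (simp add: cell_def)
  then show ?thesis ..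
qed

lemma abs_min_le: "\<bar>MIN i. c i z - w $ i\<bar> \<le> (\<Sum>i\<in>UNIV. \<bar>c i z - w $ i\<bar>)"
proof -
  have "(MIN i. c i z - w $ i) \<in> range (\<lambda>i. c i z - w $ i)" by (intro Min_in) auto
  then obtain i where "(MIN i. c i z - w $ i) = c i z - w $ i" by (rule rangeE)
  then show ?thesis using member_le_sum[of i UNIV "\<lambda>i. \<bar>c i z - w $ i\<bar>"] by simp
qed

lemma integrable_min: "integrable P (\<lambda>z. MIN i. c i z - w $ i)"
proof (rule Bochner_Integration.integrable_bound)
  show "integrable P (\<lambda>z. \<Sum>i\<in>UNIV. \<bar>c i z - w $ i\<bar>)"
    using integrable_cost by (auto intro!: integrable_const)
  show "AE z in P. norm (MIN i. c i z - w $ i) \<le> norm (\<Sum>i\<in>UNIV. \<bar>c i z - w $ i\<bar>)"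
    using abs_min_le[where w = w] by (intro AE_I2) (simp add: sum_nonneg)
qed simp

lemma AE_unique_cell: "AE z in P. \<exists>!i. z \<in> cell w i"
proof -
  have "AE z in P. \<forall>i\<in>UNIV. \<forall>j\<in>UNIV. i \<noteq> j \<longrightarrow> c i z - c j z \<noteq> w $ i - w $ j"
    using no_ties by (intro AE_finite_allI) auto
  then show ?thesis
  proof (rule AE_mp, intro AE_I2 impI)
    fix z assume z: "z \<in> space P"
      and ne: "\<forall>i\<in>UNIV. \<forall>j\<in>UNIV. i \<noteq> j \<longrightarrow> c i z - c j z \<noteq> w $ i - w $ j"
    from ex_cell[OF z] obtain i where i: "z \<in> cell w i" by blast
    have "j = i" if j: "z \<in> cell w j" for j
    proof (rule ccontr)
      have "c i z - w $ i = c j z - w $ j" using i j by (auto simp: cell_def intro: antisym)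
      then have "c i z - c j z = w $ i - w $ j" by simp
      moreover assume "j \<noteq> i"
      ultimately show False using bspec[OF bspec[OF ne UNIV_I[of i]] UNIV_I[of j]] by simp
    qed
    with i show "\<exists>!i. z \<in> cell w i" by blast
  qed
qed

lemma sum_indicator_cells:
  assumes "z \<in> cell w i" "\<exists>!i. z \<in> cell w i"
  shows "(\<Sum>j\<in>UNIV. indicat_real (cell w j) z * u j) = u i"
proof -
  have "(\<Sum>j\<in>UNIV. indicat_real (cell w j) z * u j) = (\<Sum>j\<in>UNIV. if j = i then u i else 0)"
    by (intro sum.cong refl) (use assms in \<open>auto simp: indicator_def\<close>)
  then show ?thesis by simp
qed

lemma integrable_sum_indicator_cells:
  "integrable P (\<lambda>z. \<Sum>i\<in>UNIV. indicat_real (cell w i) z * u i)"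
  by (intro Bochner_Integration.integrable_sum integrable_mult_left integrable_real_indicator)
     (auto simp: emeasure_eq_measure)

lemma integral_sum_indicator_cells:
  "(\<integral>z. (\<Sum>i\<in>UNIV. indicat_real (cell w i) z * u i) \<partial>P) = (\<Sum>i\<in>UNIV. prob (cell w i) * u i)"
proof -
  have "(\<integral>z. (\<Sum>i\<in>UNIV. indicat_real (cell w i) z * u i) \<partial>P)
      = (\<Sum>i\<in>UNIV. \<integral>z. indicat_real (cell w i) z * u i \<partial>P)"
    by (intro Bochner_Integration.integral_sum integrable_mult_left integrable_real_indicator)
       (auto simp: emeasure_eq_measure)
  then show ?thesis by simp
qed

lemma sum_prob_cells: "(\<Sum>i\<in>UNIV. prob (cell w i)) = 1"
proof -
  have "(\<Sum>i\<in>UNIV. prob (cell w i)) = (\<integral>z. (\<Sum>i\<in>UNIV. indicat_real (cell w i) z * 1) \<partial>P)"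
    unfolding integral_sum_indicator_cells by simp
  also have "\<dots> = (\<integral>z. 1 \<partial>P)"
  proof (rule integral_cong_AE)
    show "AE z in P. (\<Sum>i\<in>UNIV. indicat_real (cell w i) z * 1) = 1"
      using AE_unique_cell[of w]
    proof (rule AE_mp, intro AE_I2 impI)
      fix z assume ex1: "\<exists>!i. z \<in> cell w i"
      then obtain i where "z \<in> cell w i" by blast
      from sum_indicator_cells[OF this ex1] show "(\<Sum>i\<in>UNIV. indicat_real (cell w i) z * 1) = 1" .
    qed
  qed auto
  finally show ?thesis by (simp add: prob_space)
qed

lemma direction_inner: "direction w z \<bullet> u = a \<bullet> u - (\<Sum>i\<in>UNIV. indicat_real (cell w i) z * u $ i)"
  by (simp add: direction_def inner_vec_def left_diff_distrib sum_subtractf)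

lemma mean_direction_inner: "mean_direction w \<bullet> u = a \<bullet> u - (\<Sum>i\<in>UNIV. prob (cell w i) * u $ i)"
  by (simp add: mean_direction_def inner_vec_def left_diff_distrib sum_subtractf)

lemma integral_direction_inner: "(\<integral>z. direction w z \<bullet> u \<partial>P) = mean_direction w \<bullet> u"
  unfolding direction_inner mean_direction_inner integral_sum_indicator_cells[symmetric]
  by (subst Bochner_Integration.integral_diff[OF _ integrable_sum_indicator_cells])
     (simp_all add: prob_space)

text \<open>
  On the cell of \<open>i\<close> for \<open>w\<close>, the minimum for \<open>v\<close> is at most \<open>c i z - v $ i\<close>, which is the
  minimum for \<open>w\<close> minus \<open>(v - w) $ i\<close>. Almost every location lies in exactly one cell, so
  integration gives the claim.
\<close>

lemma supergradient: "objective v \<le> objective w + mean_direction w \<bullet> (v - w)"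
proof -
  note int_ind = integrable_sum_indicator_cells[of w "\<lambda>i. (v - w) $ i"]
  have "(\<integral>z. (MIN i. c i z - v $ i) \<partial>P)
      \<le> (\<integral>z. (MIN i. c i z - w $ i) - (\<Sum>i\<in>UNIV. indicat_real (cell w i) z * (v - w) $ i) \<partial>P)"
  proof (rule integral_mono_AE)
    show "AE z in P. (MIN i. c i z - v $ i)
        \<le> (MIN i. c i z - w $ i) - (\<Sum>i\<in>UNIV. indicat_real (cell w i) z * (v - w) $ i)"
      using AE_unique_cell[of w]
    proof (rule AE_mp, intro AE_I2 impI)
      fix z assume ex1: "\<exists>!i. z \<in> cell w i"
      then obtain i where i: "z \<in> cell w i" by blast
      show "(MIN i. c i z - v $ i)
          \<le> (MIN i. c i z - w $ i) - (\<Sum>i\<in>UNIV. indicat_real (cell w i) z * (v - w) $ i)"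
        unfolding sum_indicator_cells[OF i ex1] min_eq_on_cell[OF i]
        using min_le[of z v i] by simp
    qed
  qed (intro integrable_min int_ind Bochner_Integration.integrable_diff)+
  also have "\<dots> = (\<integral>z. (MIN i. c i z - w $ i) \<partial>P) - (\<Sum>i\<in>UNIV. prob (cell w i) * (v - w) $ i)"
    unfolding Bochner_Integration.integral_diff[OF integrable_min int_ind]
      integral_sum_indicator_cells ..
  finally have "(\<integral>z. (MIN i. c i z - v $ i) \<partial>P)
    \<le> (\<integral>z. (MIN i. c i z - w $ i) \<partial>P) - (\<Sum>i\<in>UNIV. prob (cell w i) * (v - w) $ i)" .
  then show ?thesis
    using mean_direction_inner[of w "v - w"] inner_diff_right[of a v w]
    unfolding objective_def by linarith
qed

lemma norm_direction_le: "norm (direction w z) \<le> CARD('n)"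
proof -
  have "norm (direction w z) \<le> (\<Sum>i\<in>UNIV. \<bar>direction w z $ i\<bar>)" by (rule norm_le_l1_cart)
  also have "\<dots> \<le> (\<Sum>i\<in>(UNIV::'n set). 1)"
  proof (rule sum_mono)
    fix i show "\<bar>direction w z $ i\<bar> \<le> 1"
      using weight_pos[of i] weight_le_1[of i]
      unfolding direction_def vec_lambda_beta indicator_def by (simp add: abs_le_iff)
  qed
  finally show ?thesis by simp
qed

lemma norm_mean_direction_le: "norm (mean_direction w) \<le> CARD('n)"
proof -
  have "norm (mean_direction w) \<le> (\<Sum>i\<in>UNIV. \<bar>mean_direction w $ i\<bar>)" by (rule norm_le_l1_cart)
  also have "\<dots> \<le> (\<Sum>i\<in>(UNIV::'n set). 1)"
  proof (rule sum_mono)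
    fix i show "\<bar>mean_direction w $ i\<bar> \<le> 1"
      using weight_pos[of i] weight_le_1[of i] measure_nonneg[of P "cell w i"] prob_le_1[of "cell w i"]
      unfolding mean_direction_def vec_lambda_beta by linarith
  qed
  finally show ?thesis by simp
qed

text \<open>
  Exchanging the roles of the two points in the supergradient inequality gives a Lipschitz
  bound.
\<close>

lemma continuous_objective: "continuous_on UNIV objective"
proof -
  have *: "objective v - objective w \<le> CARD('n) * dist v w" for v w
  proof -
    have "objective v - objective w \<le> mean_direction w \<bullet> (v - w)" using supergradient[of v w] by simp
    also have "\<dots> \<le> norm (mean_direction w) * norm (v - w)" by (rule norm_cauchy_schwarz)
    also have "\<dots> \<le> CARD('n) * norm (v - w)" by (intro mult_right_mono norm_mean_direction_le) simp
    finally show ?thesis by (simp add: dist_norm)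
  qed
  have "(CARD('n))-lipschitz_on UNIV objective"
  proof (rule lipschitz_onI)
    fix v w show "dist (objective v) (objective w) \<le> CARD('n) * dist v w"
      using *[of v w] *[of w v] by (simp add: dist_real_def abs_le_iff dist_commute)
  qed simp
  then show ?thesis by (rule lipschitz_on_continuous_on)
qed

lemma objective_translate: "objective (w + (\<chi> i. t)) = objective w"
proof -
  have "(MIN i. c i z - (w + (\<chi> i. t)) $ i) = (MIN i. c i z - w $ i) - t" for z
  proof -
    have "(MIN i. c i z - w $ i) - t = (MIN i. (c i z - w $ i) - t)"
      using hom_Min_commute[of "\<lambda>x. x - t" "range (\<lambda>i. c i z - w $ i)"] by (simp add: image_image min_diff_distrib_left)
    then show ?thesis by (simp add: algebra_simps)
  qed
  moreover have "a \<bullet> (\<chi> i. t) = t"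
    by (simp add: inner_vec_def weight_sum sum_distrib_right[symmetric])
  ultimately show ?thesis
    by (simp add: objective_def integrable_min prob_space inner_add_right)
qed

text \<open>
  By invariance under translation by constant vectors, the largest weight may be taken to be
  \<open>0\<close>. Then the integral is at most the mean cost of a generator of weight \<open>0\<close>, while
  \<open>a \<bullet> w\<close> tends to minus infinity with any single weight because all \<open>a $ i\<close> are
  positive. So some compact box contains a global maximizer.
\<close>

lemma ex_maximizer: "\<exists>w. \<forall>v. objective v \<le> objective w"
proof -
  define K where "K = (\<Sum>i\<in>UNIV. \<integral>z. \<bar>c i z\<bar> \<partial>P)"
  define m where "m = Min (range (($) a))"
  have m: "0 < m" "m \<le> a $ i" for i
    unfolding m_def using weight_pos by (auto simp: Min_gr_iff)
  \<comment> \<open>\<open>R\<close> is large enough that a weight below \<open>- R\<close> pushes the objective under its value at \<open>0\<close>.\<close>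
  define R where "R = (\<bar>K\<bar> + \<bar>objective 0\<bar> + 1) / m"
  have Rm: "R * m = \<bar>K\<bar> + \<bar>objective 0\<bar> + 1" using m(1) by (simp add: R_def)
  have R0: "0 \<le> R" using m(1) by (simp add: R_def)
  define box where "box = {(\<chi> i. - R)..(0::real^'n)}"
  have "compact box" by (simp add: box_def)
  moreover have "0 \<in> box" using R0 by (auto simp: box_def less_eq_vec_def)
  ultimately obtain w where w: "w \<in> box" "\<And>v. v \<in> box \<Longrightarrow> objective v \<le> objective w"
    using continuous_attains_sup[of box objective] continuous_on_subset[OF continuous_objective] by blast
  have "objective v \<le> objective w" for v
  proof -
    define t where "t = Max (range (($) v))"
    define u where "u = v + (\<chi> i. - t)"
    have t: "v $ i \<le> t" for i unfolding t_def by (intro Max_ge) auto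
    have "t \<in> range (($) v)" unfolding t_def by (intro Max_in) auto
    then obtain j where j: "t = v $ j" by auto
    have u0: "u $ i \<le> 0" for i using t[of i] by (simp add: u_def)
    have uj: "u $ j = 0" by (simp add: u_def j)
    have uv: "objective v = objective u" unfolding u_def by (rule objective_translate[symmetric])
    show ?thesis
    proof (cases "\<forall>i. - R \<le> u $ i")
      case True
      then have "u \<in> box" using u0 by (auto simp: box_def less_eq_vec_def)
      then show ?thesis using w(2) uv by simp
    next
      case False
      then obtain i where i: "u $ i < - R" by (auto simp: not_le)
      have "(\<integral>z. (MIN i. c i z - u $ i) \<partial>P) \<le> (\<integral>z. \<bar>c j z\<bar> \<partial>P)"
      proof (rule integral_mono)
        fix z show "(MIN i. c i z - u $ i) \<le> \<bar>c j z\<bar>" using min_le[of z u j] uj by simp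
      qed (auto simp: integrable_min integrable_cost)
      also have "\<dots> \<le> K" unfolding K_def by (rule member_le_sum) auto
      finally have 1: "(\<integral>z. (MIN i. c i z - u $ i) \<partial>P) \<le> K" .
      have "- (a \<bullet> u) = (\<Sum>k\<in>UNIV. a $ k * - (u $ k))"
        by (simp add: inner_vec_def sum_negf)
      moreover have "a $ i * - (u $ i) \<le> (\<Sum>k\<in>UNIV. a $ k * - (u $ k))"
        using u0 weight_pos by (intro member_le_sum) (auto simp: mult_nonneg_nonpos less_imp_le)
      moreover have "R * m \<le> a $ i * - (u $ i)"
        using mult_mono[of m "a $ i" R "- (u $ i)"] m i R0 less_imp_le[OF weight_pos[of i]]
        by (simp add: mult.commute)
      ultimately have "a \<bullet> u \<le> - (R * m)" by linarith
      with 1 have "objective u \<le> objective 0" unfolding objective_def[of u] Rm by linarith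
      then show ?thesis using w(2)[OF \<open>0 \<in> box\<close>] uv by simp
    qed
  qed
  then show ?thesis by blast
qed

text \<open>
  The argument is one-sided. Raise the weight of \<open>i\<close> slightly above its optimal value: the
  supergradient inequality at the raised point shows that the enlarged cell of \<open>i\<close> has mass at
  least \<open>a $ i\<close>. The enlarged cells decrease to the original one, so its mass is at least
  \<open>a $ i\<close> as well. Both families of masses sum to one, hence they agree.
\<close>

lemma prob_cell_maximizer:
  assumes max: "\<And>v. objective v \<le> objective w"
  shows "prob (cell w i) = a $ i"
proof -
  have ge: "a $ i \<le> prob (cell w i)" for i
  proof -
    define v where "v n = w + (inverse (real (Suc n))) *\<^sub>R axis i 1" for n
    have v_i: "v n $ i = w $ i + inverse (real (Suc n))" for n by (simp add: v_def)
    have v_j: "v n $ j = w $ j" if "j \<noteq> i" for n j using that by (simp add: v_def axis_def)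
    have "a $ i \<le> prob (cell (v n) i)" for n
    proof -
      have "0 \<le> mean_direction (v n) \<bullet> (w - v n)" using supergradient[of w "v n"] max[of "v n"] by simp
      also have "\<dots> = inverse (real (Suc n)) * (prob (cell (v n) i) - a $ i)"
        by (simp add: v_def inner_axis mean_direction_def algebra_simps)
      finally show ?thesis by (simp add: zero_le_mult_iff del: of_nat_Suc)
    qed
    moreover have "(\<lambda>n. prob (cell (v n) i)) \<longlonglongrightarrow> prob (\<Inter>n. cell (v n) i)"
    proof (rule finite_Lim_measure_decseq)
      have "cell (v n) i \<subseteq> cell (v m) i" if "m \<le> n" for m n
      proof
        fix z assume z: "z \<in> cell (v n) i"
        have "c i z - v m $ i \<le> c j z - v m $ j" for j
        proof (cases "j = i")
          case False
          have "inverse (real (Suc n)) \<le> inverse (real (Suc m))" using that by simp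
          moreover have "c i z - v n $ i \<le> c j z - v n $ j" using z by (simp add: cell_def)
          ultimately show ?thesis unfolding v_i v_j[OF False] by linarith
        qed simp
        with z show "z \<in> cell (v m) i" by (simp add: cell_def)
      qed
      then show "decseq (\<lambda>n. cell (v n) i)" by (auto simp: decseq_def)
    qed auto
    moreover have "(\<Inter>n. cell (v n) i) = cell w i"
    proof (intro equalityI subsetI)
      fix z assume z: "z \<in> (\<Inter>n. cell (v n) i)"
      have "c i z - w $ i \<le> c j z - w $ j" for j
      proof (cases "j = i")
        case False
        have "c i z - w $ i - (c j z - w $ j) \<le> inverse (real (Suc n))" for n
        proof -
          have "c i z - v n $ i \<le> c j z - v n $ j" using z by (simp add: cell_def)
          then show ?thesis using False by (simp add: v_i v_j del: of_nat_Suc)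
        qed
        then have "c i z - w $ i - (c j z - w $ j) \<le> 0"
          by (intro LIMSEQ_le_const[OF LIMSEQ_inverse_real_of_nat] exI allI impI)
        then show ?thesis by simp
      qed simp
      with z show "z \<in> cell w i" by (simp add: cell_def)
    next
      fix z assume z: "z \<in> cell w i"
      have "c i z - v n $ i \<le> c j z - v n $ j" for j n
      proof (cases "j = i")
        case False
        have "0 \<le> inverse (real (Suc n))" by simp
        moreover have "c i z - w $ i \<le> c j z - w $ j" using z by (simp add: cell_def)
        ultimately show ?thesis using False unfolding v_i v_j[OF False] by linarith
      qed simp
      with z show "z \<in> (\<Inter>n. cell (v n) i)" by (simp add: cell_def)
    qed
    ultimately show ?thesis by (intro LIMSEQ_le_const[of _ "prob (cell w i)"] exI allI impI) simp_all
  qed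
  have "(\<Sum>i\<in>UNIV. prob (cell w i) - a $ i) = 0"
    by (simp add: sum_subtractf sum_prob_cells weight_sum)
  then have "\<forall>i\<in>UNIV. prob (cell w i) - a $ i = 0"
    using ge by (subst sum_nonneg_eq_0_iff[symmetric]) auto
  then show ?thesis by simp
qed

lemma measurable_direction [measurable]:
  "(\<lambda>(w, z). direction w z) \<in> borel_measurable (borel \<Otimes>\<^sub>M P)"
proof -
  have [measurable]: "(\<lambda>x. x $ i) \<in> borel_measurable borel" for i :: 'n
    by (intro borel_measurable_continuous_onI continuous_intros)
  have [measurable]: "(\<lambda>p. indicat_real (cell (fst p) i) (snd p)) \<in> borel_measurable (borel \<Otimes>\<^sub>M P)" for i
  proof -
    have "(\<lambda>p. if \<forall>j. c i (snd p) - fst p $ i \<le> c j (snd p) - fst p $ j then 1 else 0 :: real)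
        \<in> borel_measurable (borel \<Otimes>\<^sub>M P)" by measurable
    then show ?thesis
      by (rule measurable_cong[THEN iffD1, rotated]) (auto simp: cell_def space_pair_measure indicator_def)
  qed
  show ?thesis
  proof (rule borel_measurable_euclidean_space[THEN iffD2], rule ballI)
    fix b :: "real^'n"
    show "(\<lambda>p. (case p of (w, z) \<Rightarrow> direction w z) \<bullet> b) \<in> borel_measurable (borel \<Otimes>\<^sub>M P)"
      unfolding case_prod_beta direction_inner by measurable
  qed
qed

end

section \<open>Convergence from distances to maximizers\<close>

text \<open>
  If the gaps stayed above \<open>e\<close> from some index on, their weighted sum would exceed \<open>e\<close> times a
  tail of a divergent series.
\<close>

lemma weighted_gap_frequently_small:
  fixes \<gamma> d :: "nat \<Rightarrow> real"
  assumes \<gamma>: "\<And>k. 0 \<le> \<gamma> k" and div: "filterlim (\<lambda>K. \<Sum>k<K. \<gamma> k) at_top sequentially"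
    and d: "\<And>k. 0 \<le> d k" and bdd: "\<And>n. (\<Sum>k<n. \<gamma> k * d k) \<le> B" and e: "0 < e"
  shows "\<exists>\<^sub>F k in sequentially. d k < e"
proof (rule ccontr)
  assume "\<not> ?thesis"
  then obtain N where N: "\<And>k. N \<le> k \<Longrightarrow> e \<le> d k"
    by (auto simp: frequently_def eventually_sequentially not_less)
  have "(\<Sum>k<n. \<gamma> k) \<le> (\<Sum>k<N. \<gamma> k) + B / e" for n
  proof -
    have "e * (\<Sum>k<n. \<gamma> k) \<le> (\<Sum>k<n. \<gamma> k * d k) + e * (\<Sum>k<N. \<gamma> k)"
    proof (induction n)
      case 0 show ?case using e \<gamma> by (simp add: sum_nonneg)
    next
      case (Suc n)
      show ?case
      proof (cases "N \<le> n")
        case True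
        have "e * \<gamma> n \<le> \<gamma> n * d n" using mult_right_mono[OF N[OF True] \<gamma>[of n]] by (simp add: mult.commute)
        then show ?thesis using Suc by (simp add: algebra_simps)
      next
        case False
        then have "(\<Sum>k<Suc n. \<gamma> k) \<le> (\<Sum>k<N. \<gamma> k)" by (intro sum_mono2) (auto simp: \<gamma>)
        then have "e * (\<Sum>k<Suc n. \<gamma> k) \<le> e * (\<Sum>k<N. \<gamma> k)" using e by simp
        moreover have "0 \<le> (\<Sum>k<Suc n. \<gamma> k * d k)" by (intro sum_nonneg mult_nonneg_nonneg \<gamma> d)
        ultimately show ?thesis by linarith
      qed
    qed
    also have "\<dots> \<le> e * (\<Sum>k<N. \<gamma> k) + B" using bdd[of n] by simp
    finally show ?thesis using e by (simp add: field_simps)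
  qed
  moreover have "\<forall>\<^sub>F n in sequentially. (\<Sum>k<N. \<gamma> k) + B / e + 1 \<le> (\<Sum>k<n. \<gamma> k)"
    using div by (simp add: filterlim_at_top)
  then obtain n where "(\<Sum>k<N. \<gamma> k) + B / e + 1 \<le> (\<Sum>k<n. \<gamma> k)"
    by (auto simp: eventually_sequentially)
  ultimately show False by (smt (verit))
qed

text \<open>
  Since the set of maximizers may contain more than one point, convergence of the objective
  values does not suffice. A subsequence along which the objective tends to its maximum has a
  cluster point \<open>v\<close> that is a maximizer. The distances from the sequence to points of \<open>T\<close> near
  \<open>v\<close> converge, and their limits, read off along the subsequence, are small; so the whole
  sequence tends to \<open>v\<close>. It is enough to control the distances to a dense set \<open>T\<close>, which may
  be countable; this is what allows the almost sure statements for single maximizers to be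
  combined.
\<close>

lemma converges_if_distances_converge:
  fixes x :: "nat \<Rightarrow> 'e::euclidean_space" and h :: "'e \<Rightarrow> real"
  assumes cont: "continuous_on UNIV h" and le: "\<And>v. h v \<le> m"
    and T: "T \<noteq> {}" and dense: "{v. h v = m} \<subseteq> closure T"
    and dist: "\<And>t. t \<in> T \<Longrightarrow> convergent (\<lambda>k. dist (x k) t)"
    and freq: "\<And>e. 0 < e \<Longrightarrow> \<exists>\<^sub>F k in sequentially. m - h (x k) < e"
  shows "\<exists>v. x \<longlonglongrightarrow> v \<and> h v = m"
proof -
  have "\<exists>r. strict_mono r \<and> (\<forall>n. m - h (x (r n)) < inverse (of_nat (Suc n)))"
  proof -
    have "\<exists>k>p. m - h (x k) < inverse (of_nat (Suc n))" for p n :: nat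
      using freq[of "inverse (of_nat (Suc n))"] unfolding frequently_sequentially
      by (metis Suc_le_eq inverse_positive_iff_positive of_nat_0_less_iff zero_less_Suc)
    then obtain s where s: "\<And>p n. p < s p n" "\<And>p n. m - h (x (s p n)) < inverse (of_nat (Suc n))"
      by metis
    define r where "r = rec_nat (s 0 0) (\<lambda>n p. s p (Suc n))"
    have r: "r 0 = s 0 0" "r (Suc n) = s (r n) (Suc n)" for n by (simp_all add: r_def)
    have "strict_mono r" by (rule strict_monoI_Suc) (simp add: r s)
    moreover have "m - h (x (r n)) < inverse (of_nat (Suc n))" for n
      by (cases n) (simp_all only: r s)
    ultimately show ?thesis by blast
  qed
  then obtain r where r: "strict_mono r" "\<And>n. m - h (x (r n)) < inverse (of_nat (Suc n))" by blast
  have lim_h: "(\<lambda>n. h (x (r n))) \<longlonglongrightarrow> m"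
  proof (rule tendsto_sandwich)
    show "(\<lambda>n. m - inverse (real (Suc n))) \<longlonglongrightarrow> m"
      using tendsto_diff[OF tendsto_const LIMSEQ_inverse_real_of_nat, of m] by simp
    show "\<forall>\<^sub>F n in sequentially. m - inverse (real (Suc n)) \<le> h (x (r n))"
      using r(2) by (intro always_eventually allI) (smt (verit))
  qed (use le in auto)
  obtain t0 where t0: "t0 \<in> T" using T by blast
  have "Bseq (\<lambda>k. dist (x k) t0)" using dist[OF t0] by (rule convergent_imp_Bseq)
  then obtain K where K: "\<And>k. dist (x k) t0 \<le> K" by (auto simp: Bseq_def)
  have "bounded (range (x \<circ> r))"
    unfolding bounded_def using K by (auto simp: dist_commute intro!: exI[of _ t0] exI[of _ K])
  from bounded_imp_convergent_subsequence[OF this]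
  obtain v s where s: "strict_mono s" and v: "((x \<circ> r) \<circ> s) \<longlonglongrightarrow> v" by blast
  define q where "q = r \<circ> s"
  have q: "strict_mono q" using r(1) s by (simp add: q_def strict_mono_o)
  have xq: "(\<lambda>n. x (q n)) \<longlonglongrightarrow> v" using v by (simp add: q_def o_def)
  have "(\<lambda>n. h (x (q n))) \<longlonglongrightarrow> h v"
    using continuous_on_tendsto_compose[OF cont xq] by simp
  moreover have "(\<lambda>n. h (x (q n))) \<longlonglongrightarrow> m"
    using LIMSEQ_subseq_LIMSEQ[OF lim_h s] by (simp add: q_def o_def)
  ultimately have hv: "h v = m" by (rule LIMSEQ_unique)
  have "x \<longlonglongrightarrow> v"
  proof (rule metric_LIMSEQ_I)
    fix e :: real assume e: "0 < e"
    obtain t where t: "t \<in> T" "dist t v < e / 3"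
      using hv dense e closure_approachable[of v T] by (metis (mono_tags) divide_pos_pos mem_Collect_eq subsetD zero_less_numeral)
    obtain l where l: "(\<lambda>k. dist (x k) t) \<longlonglongrightarrow> l" using dist[OF t(1)] by (auto simp: convergent_def)
    have "(\<lambda>n. dist (x (q n)) t) \<longlonglongrightarrow> dist v t" by (intro tendsto_intros xq)
    moreover have "(\<lambda>n. dist (x (q n)) t) \<longlonglongrightarrow> l"
      using LIMSEQ_subseq_LIMSEQ[OF l q] by (simp add: o_def)
    ultimately have "l = dist v t" using LIMSEQ_unique by blast
    then have "l < e / 3" using t(2) by (simp add: dist_commute)
    then obtain N where "\<And>k. N \<le> k \<Longrightarrow> dist (x k) t < e / 3"
      using order_tendstoD(2)[OF l] unfolding eventually_sequentially by blast
    then have "dist (x k) v < e" if "N \<le> k" for k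
      using dist_triangle[of "x k" v t] t(2) that e by fastforce
    then show "\<exists>N. \<forall>k\<ge>N. dist (x k) v < e" by blast
  qed
  with hv show ?thesis by blast
qed

section \<open>Stochastic supergradient ascent\<close>

locale stochastic_dual_ascent = semidiscrete_dual P c a + sample: prob_space M
  for P :: "'z measure" and c :: "'n::finite \<Rightarrow> 'z \<Rightarrow> real" and a :: "real^'n"
    and M :: "'b measure" +
  fixes Y :: "nat \<Rightarrow> 'b \<Rightarrow> 'z" and \<gamma> :: "nat \<Rightarrow> real"
    and W :: "nat \<Rightarrow> 'b \<Rightarrow> real^'n" and w0 :: "real^'n"
  assumes indep: "sample.indep_vars (\<lambda>_. P) Y UNIV"
    and distr_sample: "distr M P (Y k) = P"
    and step_nonneg: "0 \<le> \<gamma> k"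
    and step_diverges: "filterlim (\<lambda>K. \<Sum>k<K. \<gamma> k) at_top sequentially"
    and step_square_summable: "summable (\<lambda>k. (\<gamma> k)\<^sup>2)"
    and iterate_0: "\<omega> \<in> space M \<Longrightarrow> W 0 \<omega> = w0"
    and iterate_Suc: "\<omega> \<in> space M \<Longrightarrow>
      W (Suc k) \<omega> = W k \<omega> + \<gamma> k *\<^sub>R direction (W k \<omega>) (Y k \<omega>)"
begin

lemma measurable_sample [measurable]: "Y k \<in> measurable M P"
  using indep by (simp add: sample.indep_vars_def)

lemma measurable_iterate_past: "W k \<in> borel_measurable (sample.past P Y k)"
proof (induction k)
  case 0
  show ?case
    by (rule measurable_cong[THEN iffD2, of _ _ "\<lambda>_. w0"]) (simp_all add: iterate_0)
next
  case (Suc k)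
  have [measurable]: "W k \<in> borel_measurable (sample.past P Y (Suc k))"
    by (rule measurable_from_subalg[OF sample.subalgebra_past_Suc[OF measurable_sample] Suc])
  have [measurable]: "Y k \<in> measurable (sample.past P Y (Suc k)) P"
    by (rule sample.measurable_past[OF measurable_sample]) simp
  have [measurable]: "(\<lambda>\<omega>. direction (W k \<omega>) (Y k \<omega>)) \<in> borel_measurable (sample.past P Y (Suc k))"
    by measurable
  have "(\<lambda>\<omega>. W k \<omega> + \<gamma> k *\<^sub>R direction (W k \<omega>) (Y k \<omega>))
      \<in> borel_measurable (sample.past P Y (Suc k))" by measurable
  then show ?case
    by (rule measurable_cong[THEN iffD2, rotated]) (simp add: iterate_Suc)
qed

lemma measurable_iterate [measurable]: "W k \<in> borel_measurable M"
  by (rule measurable_from_subalg[OF sample.subalgebra_past[OF measurable_sample] measurable_iterate_past])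

text \<open>
  A bound valid at every sample point, which makes the functions of the \<open>k\<close>-th iterate below
  integrable. It grows with the divergent sum of the steps, so it cannot control the noise
  series.
\<close>

definition iterate_bound :: "nat \<Rightarrow> real" where
  "iterate_bound k = norm w0 + real CARD('n) * (\<Sum>j<k. \<gamma> j)"

lemma norm_iterate_le: "\<omega> \<in> space M \<Longrightarrow> norm (W k \<omega>) \<le> iterate_bound k"
proof (induction k)
  case 0 then show ?case by (simp add: iterate_0 iterate_bound_def)
next
  case (Suc k)
  have "norm (W (Suc k) \<omega>) \<le> norm (W k \<omega>) + \<gamma> k * norm (direction (W k \<omega>) (Y k \<omega>))"
    unfolding iterate_Suc[OF Suc.prems]
    using norm_triangle_ineq[of "W k \<omega>"] step_nonneg[of k] by (metis abs_of_nonneg norm_scaleR)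
  also have "\<gamma> k * norm (direction (W k \<omega>) (Y k \<omega>)) \<le> \<gamma> k * real CARD('n)"
    by (intro mult_left_mono norm_direction_le step_nonneg)
  finally show ?case using Suc by (simp add: iterate_bound_def algebra_simps)
qed

text \<open>
  The random error of the \<open>k\<close>-th step as it enters the squared distance to \<open>u\<close>.
\<close>

definition noise :: "real^'n \<Rightarrow> nat \<Rightarrow> 'b \<Rightarrow> real" where
  "noise u k \<omega> = \<gamma> k * ((direction (W k \<omega>) (Y k \<omega>) - mean_direction (W k \<omega>)) \<bullet> (W k \<omega> - u))"

lemma abs_noise_le: "\<bar>noise u k \<omega>\<bar> \<le> \<gamma> k * (2 * real CARD('n) * norm (W k \<omega> - u))"
proof -
  have "\<bar>(direction (W k \<omega>) (Y k \<omega>) - mean_direction (W k \<omega>)) \<bullet> (W k \<omega> - u)\<bar>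
      \<le> norm (direction (W k \<omega>) (Y k \<omega>) - mean_direction (W k \<omega>)) * norm (W k \<omega> - u)"
    by (rule Cauchy_Schwarz_ineq2)
  also have "\<dots> \<le> (2 * real CARD('n)) * norm (W k \<omega> - u)"
    using norm_triangle_ineq4[of "direction (W k \<omega>) (Y k \<omega>)" "mean_direction (W k \<omega>)"]
      norm_direction_le[of "W k \<omega>" "Y k \<omega>"] norm_mean_direction_le[of "W k \<omega>"]
    by (intro mult_right_mono norm_ge_zero) linarith
  finally show ?thesis
    unfolding noise_def abs_mult using step_nonneg[of k] by (simp add: mult_left_mono)
qed

lemma norm_iterate_diff_le: "\<omega> \<in> space M \<Longrightarrow> norm (W k \<omega> - u) \<le> iterate_bound k + norm u"
  using norm_triangle_ineq4[of "W k \<omega>" u] norm_iterate_le[of \<omega> k] by linarith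

definition noise_bound :: "real^'n \<Rightarrow> nat \<Rightarrow> real" where
  "noise_bound u k = \<gamma> k * (2 * real CARD('n) * (iterate_bound k + norm u))"

lemma noise_bounded: "\<omega> \<in> space M \<Longrightarrow> \<bar>noise u k \<omega>\<bar> \<le> noise_bound u k"
  by (rule order.trans[OF abs_noise_le])
     (auto simp: noise_bound_def intro!: mult_left_mono step_nonneg norm_iterate_diff_le)

lemma measurable_mean_direction [measurable]: "mean_direction \<in> borel_measurable borel"
proof (rule borel_measurable_euclidean_space[THEN iffD2], rule ballI)
  fix b :: "real^'n"
  show "(\<lambda>w. mean_direction w \<bullet> b) \<in> borel_measurable borel"
    unfolding integral_direction_inner[symmetric] by measurable
qed

lemma measurable_noise_past: "noise u k \<in> borel_measurable (sample.past P Y (Suc k))"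
proof -
  have [measurable]: "W k \<in> borel_measurable (sample.past P Y (Suc k))"
    by (rule measurable_from_subalg[OF sample.subalgebra_past_Suc[OF measurable_sample] measurable_iterate_past])
  have [measurable]: "Y k \<in> measurable (sample.past P Y (Suc k)) P"
    by (rule sample.measurable_past[OF measurable_sample]) simp
  show ?thesis unfolding noise_def by measurable
qed

lemma measurable_noise [measurable]: "noise u k \<in> borel_measurable M"
  by (rule measurable_from_subalg[OF sample.subalgebra_past[OF measurable_sample] measurable_noise_past])

text \<open>
  The current iterate is a function of the past and the new sample is independent of it, so
  averaging over the new sample turns the observed direction into its mean.
\<close>

lemma noise_orthogonal:
  assumes X: "X \<in> borel_measurable (sample.past P Y k)" and C: "\<And>\<omega>. \<omega> \<in> space M \<Longrightarrow> \<bar>X \<omega>\<bar> \<le> C"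
  shows "sample.expectation (\<lambda>\<omega>. X \<omega> * noise u k \<omega>) = 0"
proof -
  define \<psi> where "\<psi> s y = fst s * (\<gamma> k * ((direction (snd s) y - mean_direction (snd s)) \<bullet> (snd s - u)))"
    for s :: "real \<times> (real^'n)" and y
  have pair: "(\<lambda>\<omega>. (X \<omega>, W k \<omega>)) \<in> measurable (sample.past P Y k) (borel \<Otimes>\<^sub>M borel)"
    by (intro measurable_Pair X measurable_iterate_past)
  have [measurable]: "X \<in> borel_measurable M"
    by (rule measurable_from_subalg[OF sample.subalgebra_past[OF measurable_sample] X])
  have meas: "(\<lambda>(s, y). \<psi> s y) \<in> borel_measurable ((borel \<Otimes>\<^sub>M borel) \<Otimes>\<^sub>M P)"
    unfolding \<psi>_def by measurable
  have int: "integrable M (\<lambda>\<omega>. \<psi> (X \<omega>, W k \<omega>) (Y k \<omega>))"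
  proof (rule sample.integrable_const_bound[of _ "C * noise_bound u k"])
    show "AE \<omega> in M. norm (\<psi> (X \<omega>, W k \<omega>) (Y k \<omega>)) \<le> C * noise_bound u k"
    proof (intro AE_I2)
      fix \<omega> assume "\<omega> \<in> space M"
      then have "\<bar>X \<omega>\<bar> * \<bar>noise u k \<omega>\<bar> \<le> C * noise_bound u k"
        using C[of \<omega>] noise_bounded[of \<omega> u k] by (intro mult_mono) auto
      then show "norm (\<psi> (X \<omega>, W k \<omega>) (Y k \<omega>)) \<le> C * noise_bound u k"
        by (simp add: \<psi>_def noise_def abs_mult)
    qed
  qed (simp add: \<psi>_def)
  have "(\<integral>y. \<psi> s y \<partial>P) = 0" for s
  proof -
    have "integrable P (\<lambda>y. direction (snd s) y \<bullet> (snd s - u))"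
      unfolding direction_inner
      by (intro Bochner_Integration.integrable_diff integrable_const integrable_sum_indicator_cells)
    then show ?thesis
      unfolding \<psi>_def inner_diff_left by (simp add: integral_direction_inner prob_space)
  qed
  then have "sample.expectation (\<lambda>\<omega>. \<psi> (X \<omega>, W k \<omega>) (Y k \<omega>)) = 0"
    by (subst sample.expectation_freeze_past[OF indep distr_sample pair meas int]) simp
  then show ?thesis by (simp add: \<psi>_def noise_def)
qed

sublocale noise: bounded_martingale_differences M "sample.past P Y" "noise u" "noise_bound u" for u
proof
  show "subalgebra M (sample.past P Y k)" for k
    by (rule sample.subalgebra_past[OF measurable_sample])
  show "subalgebra (sample.past P Y (Suc k)) (sample.past P Y k)" for k
    by (rule sample.subalgebra_past_Suc[OF measurable_sample])
qed (fact measurable_noise_past noise_bounded noise_orthogonal)+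

lemma norm_square_step:
  assumes "\<omega> \<in> space M"
  shows "(norm (W (Suc k) \<omega> - u))\<^sup>2 = (norm (W k \<omega> - u))\<^sup>2
    + 2 * (\<gamma> k * (mean_direction (W k \<omega>) \<bullet> (W k \<omega> - u))) + 2 * noise u k \<omega>
    + (\<gamma> k)\<^sup>2 * (norm (direction (W k \<omega>) (Y k \<omega>)))\<^sup>2"
proof -
  define e where "e = W k \<omega> - u"
  define d where "d = direction (W k \<omega>) (Y k \<omega>)"
  have "W (Suc k) \<omega> - u = e + \<gamma> k *\<^sub>R d"
    by (simp add: iterate_Suc[OF assms] e_def d_def)
  then have "(norm (W (Suc k) \<omega> - u))\<^sup>2 = (e + \<gamma> k *\<^sub>R d) \<bullet> (e + \<gamma> k *\<^sub>R d)"
    by (simp add: power2_norm_eq_inner)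
  also have "\<dots> = e \<bullet> e + 2 * (\<gamma> k * (d \<bullet> e)) + (\<gamma> k)\<^sup>2 * (d \<bullet> d)"
    by (simp add: inner_add_left inner_add_right inner_commute[of e d] power2_eq_square
        distrib_left mult.assoc)
  finally show ?thesis
    unfolding noise_def e_def[symmetric] d_def[symmetric] power2_norm_eq_inner
    by (simp add: inner_diff_left algebra_simps)
qed

text \<open>
  From here on \<open>u\<close> is a maximizer, so the mean direction at any point has a nonpositive inner
  product with the displacement from \<open>u\<close>: to first order, the mean step does not increase the
  distance to \<open>u\<close>.
\<close>

context
  fixes u :: "real^'n"
  assumes max: "\<And>v. objective v \<le> objective u"
begin

lemma gap_le_inner: "objective u - objective w \<le> - (mean_direction w \<bullet> (w - u))"
  using supergradient[of u w] by (simp add: inner_diff_right)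

lemma integrable_square_distance: "integrable M (\<lambda>\<omega>. (norm (W k \<omega> - u))\<^sup>2)"
  by (rule noise.integrable_bounded_power2[where C = "iterate_bound k + norm u"])
     (use norm_iterate_diff_le in auto)

text \<open>
  Unlike the pointwise bound, the mean squared distance stays bounded uniformly in \<open>k\<close>: the
  drift term is nonpositive, the noise has mean zero, and the quadratic terms are of the order
  of the squared steps, which are summable.
\<close>

lemma second_moment_distance_le:
  "sample.expectation (\<lambda>\<omega>. (norm (W k \<omega> - u))\<^sup>2) \<le> (norm (w0 - u))\<^sup>2 + (real CARD('n))\<^sup>2 * (\<Sum>j<k. (\<gamma> j)\<^sup>2)"
proof (induction k)
  case 0
  have "sample.expectation (\<lambda>\<omega>. (norm (W 0 \<omega> - u))\<^sup>2) = sample.expectation (\<lambda>\<omega>. (norm (w0 - u))\<^sup>2)"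
    by (intro Bochner_Integration.integral_cong) (simp_all add: iterate_0)
  then show ?case by (simp add: sample.prob_space)
next
  case (Suc k)
  have int: "integrable M (noise u k)"
    by (rule noise.integrable_bounded_fun[OF measurable_noise noise_bounded])
  have "sample.expectation (\<lambda>\<omega>. (norm (W (Suc k) \<omega> - u))\<^sup>2)
      \<le> sample.expectation (\<lambda>\<omega>. ((norm (W k \<omega> - u))\<^sup>2 + 2 * noise u k \<omega>) + (real CARD('n))\<^sup>2 * (\<gamma> k)\<^sup>2)"
  proof (rule integral_mono)
    fix \<omega> assume \<omega>: "\<omega> \<in> space M"
    have "mean_direction (W k \<omega>) \<bullet> (W k \<omega> - u) \<le> 0"
      using gap_le_inner[of "W k \<omega>"] max[of "W k \<omega>"] by linarith
    then have "\<gamma> k * (mean_direction (W k \<omega>) \<bullet> (W k \<omega> - u)) \<le> 0"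
      by (rule mult_nonneg_nonpos[OF step_nonneg])
    moreover have "(\<gamma> k)\<^sup>2 * (norm (direction (W k \<omega>) (Y k \<omega>)))\<^sup>2 \<le> (\<gamma> k)\<^sup>2 * (real CARD('n))\<^sup>2"
      by (intro mult_left_mono power_mono norm_direction_le) auto
    ultimately show "(norm (W (Suc k) \<omega> - u))\<^sup>2
        \<le> ((norm (W k \<omega> - u))\<^sup>2 + 2 * noise u k \<omega>) + (real CARD('n))\<^sup>2 * (\<gamma> k)\<^sup>2"
      unfolding norm_square_step[OF \<omega>] by (simp add: mult.commute)
  qed (simp_all add: integrable_square_distance int)
  also have "\<dots> = sample.expectation (\<lambda>\<omega>. (norm (W k \<omega> - u))\<^sup>2) + 2 * sample.expectation (noise u k) + (real CARD('n))\<^sup>2 * (\<gamma> k)\<^sup>2"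
    using integrable_square_distance int by (simp add: sample.prob_space)
  also have "sample.expectation (noise u k) = 0"
    using noise_orthogonal[of "\<lambda>_. 1" k 1 u] by simp
  finally show ?case using Suc by (simp add: algebra_simps)
qed

lemma summable_noise_second_moment: "summable (\<lambda>k. sample.expectation (\<lambda>\<omega>. (noise u k \<omega>)\<^sup>2))"
proof (rule summable_comparison_test')
  define K where "K = (2 * real CARD('n))\<^sup>2 * ((norm (w0 - u))\<^sup>2 + (real CARD('n))\<^sup>2 * (\<Sum>j. (\<gamma> j)\<^sup>2))"
  show "summable (\<lambda>k. (\<gamma> k)\<^sup>2 * K)"
    by (intro summable_mult2 step_square_summable)
  fix k
  have "sample.expectation (\<lambda>\<omega>. (noise u k \<omega>)\<^sup>2)
      \<le> sample.expectation (\<lambda>\<omega>. (\<gamma> k)\<^sup>2 * (2 * real CARD('n))\<^sup>2 * (norm (W k \<omega> - u))\<^sup>2)"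
  proof (rule integral_mono)
    show "integrable M (\<lambda>\<omega>. (noise u k \<omega>)\<^sup>2)"
      by (rule noise.integrable_bounded_power2[OF measurable_noise noise_bounded])
    fix \<omega>
    have "\<bar>noise u k \<omega>\<bar>\<^sup>2 \<le> (\<gamma> k * (2 * real CARD('n) * norm (W k \<omega> - u)))\<^sup>2"
      by (intro power_mono abs_noise_le) simp
    then show "(noise u k \<omega>)\<^sup>2 \<le> (\<gamma> k)\<^sup>2 * (2 * real CARD('n))\<^sup>2 * (norm (W k \<omega> - u))\<^sup>2"
      by (simp add: power_mult_distrib mult.assoc)
  qed (auto intro!: integrable_square_distance)
  also have "\<dots> = (\<gamma> k)\<^sup>2 * (2 * real CARD('n))\<^sup>2 * sample.expectation (\<lambda>\<omega>. (norm (W k \<omega> - u))\<^sup>2)"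
    by simp
  also have "\<dots> \<le> (\<gamma> k)\<^sup>2 * (2 * real CARD('n))\<^sup>2 * ((norm (w0 - u))\<^sup>2 + (real CARD('n))\<^sup>2 * (\<Sum>j. (\<gamma> j)\<^sup>2))"
  proof (rule mult_left_mono)
    have "(\<Sum>j<k. (\<gamma> j)\<^sup>2) \<le> (\<Sum>j. (\<gamma> j)\<^sup>2)"
      by (intro sum_le_suminf step_square_summable) auto
    then have "(real CARD('n))\<^sup>2 * (\<Sum>j<k. (\<gamma> j)\<^sup>2) \<le> (real CARD('n))\<^sup>2 * (\<Sum>j. (\<gamma> j)\<^sup>2)" by (rule mult_left_mono) simp
    then show "sample.expectation (\<lambda>\<omega>. (norm (W k \<omega> - u))\<^sup>2)
        \<le> (norm (w0 - u))\<^sup>2 + (real CARD('n))\<^sup>2 * (\<Sum>j. (\<gamma> j)\<^sup>2)"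
      using second_moment_distance_le[of k] by linarith
  qed simp
  finally show "norm (sample.expectation (\<lambda>\<omega>. (noise u k \<omega>)\<^sup>2)) \<le> (\<gamma> k)\<^sup>2 * K"
    by (simp add: K_def mult.assoc)
qed

text \<open>
  The squared distance telescopes into the initial value minus nonnegative drift terms plus
  the noise series plus a convergent series. As the left side is nonnegative and the last two
  series converge, the drift series is bounded, hence convergent. The convergence of the
  distance and the bound on the weighted optimality gaps follow together.
\<close>

lemma distance_converges_if_noise_summable:
  assumes \<omega>: "\<omega> \<in> space M" and noise: "summable (\<lambda>k. noise u k \<omega>)"
  shows "convergent (\<lambda>k. dist (W k \<omega>) u)"
    and "\<exists>B. \<forall>n. (\<Sum>k<n. \<gamma> k * (objective u - objective (W k \<omega>))) \<le> B"
proof -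
  define d where "d k = (norm (W k \<omega> - u))\<^sup>2" for k
  define g where "g k = - (\<gamma> k * (mean_direction (W k \<omega>) \<bullet> (W k \<omega> - u)))" for k
  define r where "r k = (\<gamma> k)\<^sup>2 * (norm (direction (W k \<omega>) (Y k \<omega>)))\<^sup>2" for k
  have gap: "\<gamma> k * (objective u - objective (W k \<omega>)) \<le> g k" for k
    using mult_left_mono[OF gap_le_inner step_nonneg, of k "W k \<omega>"] by (simp add: g_def)
  have g0: "0 \<le> g k" for k
    using gap[of k] max[of "W k \<omega>"] step_nonneg[of k] by (meson diff_ge_0_iff_ge mult_nonneg_nonneg order.trans)
  have d_eq: "d n = d 0 - 2 * (\<Sum>k<n. g k) + 2 * (\<Sum>k<n. noise u k \<omega>) + (\<Sum>k<n. r k)" for n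
    by (induction n) (simp_all add: d_def norm_square_step[OF \<omega>] g_def r_def)
  have r: "summable r"
  proof (rule summable_comparison_test')
    show "summable (\<lambda>k. (\<gamma> k)\<^sup>2 * (real CARD('n))\<^sup>2)" by (intro summable_mult2 step_square_summable)
    show "norm (r k) \<le> (\<gamma> k)\<^sup>2 * (real CARD('n))\<^sup>2" for k
      by (auto simp: r_def intro!: mult_left_mono power_mono norm_direction_le)
  qed
  have conv: "convergent (\<lambda>n. \<Sum>k<n. noise u k \<omega>)" "convergent (\<lambda>n. \<Sum>k<n. r k)"
    using noise r by (simp_all add: summable_iff_convergent)
  obtain B1 where B1: "\<And>n. \<bar>\<Sum>k<n. noise u k \<omega>\<bar> \<le> B1"
    using convergent_imp_Bseq[OF conv(1)] by (auto simp: Bseq_def)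
  obtain B2 where B2: "\<And>n. \<bar>\<Sum>k<n. r k\<bar> \<le> B2"
    using convergent_imp_Bseq[OF conv(2)] by (auto simp: Bseq_def)
  have g_le: "(\<Sum>k<n. g k) \<le> d 0 + B1 + B2" for n
  proof -
    have "0 \<le> d n" "0 \<le> d 0" by (simp_all add: d_def)
    then show ?thesis using d_eq[of n] B1[of n] B2[of n] by linarith
  qed
  have "convergent (\<lambda>n. \<Sum>k<n. g k)"
    using summableI_nonneg_bounded[of g, OF g0 g_le] by (simp add: summable_iff_convergent)
  then have "convergent (\<lambda>n. d 0 - 2 * (\<Sum>k<n. g k) + 2 * (\<Sum>k<n. noise u k \<omega>) + (\<Sum>k<n. r k))"
    using conv by (intro convergent_add convergent_diff convergent_const convergent_mult)
  then have "convergent d" unfolding d_eq[symmetric] .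
  then obtain l where "d \<longlonglongrightarrow> l" by (auto simp: convergent_def)
  then have "(\<lambda>k. sqrt (d k)) \<longlonglongrightarrow> sqrt l" by (rule tendsto_real_sqrt)
  then show "convergent (\<lambda>k. dist (W k \<omega>) u)"
    by (auto simp: d_def dist_norm convergent_def)
  show "\<exists>B. \<forall>n. (\<Sum>k<n. \<gamma> k * (objective u - objective (W k \<omega>))) \<le> B"
    using order.trans[OF sum_mono[of "{..<_}", OF gap] g_le] by blast
qed

lemma AE_distance_converges:
  "AE \<omega> in M. convergent (\<lambda>k. dist (W k \<omega>) u)
     \<and> (\<exists>B. \<forall>n. (\<Sum>k<n. \<gamma> k * (objective u - objective (W k \<omega>))) \<le> B)"
  using noise.AE_summable[OF summable_noise_second_moment]
  by (rule AE_mp) (auto intro!: AE_I2 distance_converges_if_noise_summable)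

end

text \<open>
  The exceptional null set depends on the maximizer to which distances are measured. It is
  therefore chosen for the points of a countable dense set of maximizers only.
\<close>

theorem AE_converges_to_maximizer:
  "AE \<omega> in M. \<exists>w. (\<lambda>k. W k \<omega>) \<longlonglongrightarrow> w \<and> (\<forall>v. objective v \<le> objective w)"
proof -
  obtain u where u: "\<And>v. objective v \<le> objective u" using ex_maximizer by blast
  define S where "S = {v. objective v = objective u}"
  obtain T where T: "countable T" "T \<subseteq> S" "S \<subseteq> closure T" using separable by blast
  have T_ne: "T \<noteq> {}" using T(3) by (auto simp: S_def)
  have "AE \<omega> in M. \<forall>t\<in>T. convergent (\<lambda>k. dist (W k \<omega>) t)
     \<and> (\<exists>B. \<forall>n. (\<Sum>k<n. \<gamma> k * (objective t - objective (W k \<omega>))) \<le> B)"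
  proof (subst AE_ball_countable[OF T(1)], intro ballI AE_distance_converges)
    show "objective v \<le> objective t" if "t \<in> T" for t v
      using T(2) u[of v] that by (auto simp: S_def)
  qed
  then show ?thesis
  proof (rule AE_mp, intro AE_I2 impI)
    fix \<omega> assume *: "\<forall>t\<in>T. convergent (\<lambda>k. dist (W k \<omega>) t)
     \<and> (\<exists>B. \<forall>n. (\<Sum>k<n. \<gamma> k * (objective t - objective (W k \<omega>))) \<le> B)"
    obtain t where t: "t \<in> T" using T_ne by blast
    have ht: "objective t = objective u" using t T(2) by (auto simp: S_def)
    obtain B where B: "\<And>n. (\<Sum>k<n. \<gamma> k * (objective u - objective (W k \<omega>))) \<le> B"
      using * t unfolding ht[symmetric] by blast
    have "\<exists>w. (\<lambda>k. W k \<omega>) \<longlonglongrightarrow> w \<and> objective w = objective u"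
    proof (rule converges_if_distances_converge[OF continuous_objective u T_ne])
      show "{v. objective v = objective u} \<subseteq> closure T" using T(3) by (simp add: S_def)
      show "\<exists>\<^sub>F k in sequentially. objective u - objective (W k \<omega>) < e" if "0 < e" for e
        using u by (intro weighted_gap_frequently_small[OF step_nonneg step_diverges _ B that]) simp
    qed (use * in blast)
    then show "\<exists>w. (\<lambda>k. W k \<omega>) \<longlonglongrightarrow> w \<and> (\<forall>v. objective v \<le> objective w)"
      using u by metis
  qed
qed

end

section \<open>Adaptive partitioning with radial costs\<close>

text \<open>
  The complement of the support is a union of open null sets. By Lindelof countably many of
  them cover it.
\<close>

lemma AE_in_measure_support:
  fixes P :: "'a::second_countable_topology measure"
  assumes P: "sets P = sets borel"
  shows "AE x in P. x \<in> measure_support P"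
proof -
  define U where "U = {V. open V \<and> emeasure P V = 0}"
  obtain U' where U': "U' \<subseteq> U" "countable U'" "\<Union>U' = \<Union>U"
    by (rule Lindelof[of U]) (auto simp: U_def)
  have "(\<Union>V\<in>U'. V) \<in> null_sets P"
    using U' by (intro null_sets_UN') (auto simp: U_def null_sets_def P)
  then have "\<Union>U \<in> null_sets P" using U'(3) by simp
  moreover have "- measure_support P \<subseteq> \<Union>U"
    by (auto simp: measure_support_def U_def)
  ultimately show ?thesis by (auto intro: AE_I')
qed

text \<open>
  Extending \<open>f\<close> by the constant \<open>f 0\<close> to negative arguments makes it monotone on the whole
  line, hence Borel.
\<close>

lemma borel_measurable_radial_cost:
  fixes y :: "'a::euclidean_space"
  assumes "mono_on {0..} f"
  shows "(\<lambda>z. radial_cost f z y) \<in> borel_measurable borel"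
proof -
  have "mono (\<lambda>x. f (max 0 x))"
    using assms by (auto simp: mono_on_def intro!: monoI)
  then have [measurable]: "(\<lambda>x. f (max 0 x)) \<in> borel_measurable borel" by (rule borel_measurable_mono)
  have "(\<lambda>z. f (max 0 (norm (z - y)))) \<in> borel_measurable borel" by measurable
  then show ?thesis by (simp add: radial_cost_def)
qed

text \<open>
  The samples are numbered from \<open>1\<close>, so the \<open>k\<close>-th iterate depends on the samples up to index
  \<open>k\<close> and the step from \<open>k\<close> uses the sample \<open>k + 1\<close>. Shifting the index aligns the two
  numberings.
\<close>

lemma (in prob_space) indep_vars_shift:
  assumes ind: "indep_vars (\<lambda>_. N) Z {1..}" and sets: "sets N = sets N'"
  shows "indep_vars (\<lambda>_. N') (\<lambda>k. Z (Suc k)) UNIV"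
proof -
  have rv: "Z k \<in> measurable M N'" if "1 \<le> k" for k
    using ind that measurable_cong_sets[OF refl sets] by (auto simp: indep_vars_def)
  let ?E = "\<lambda>k. sigma_sets (space M) {Z k -` A \<inter> space M | A. A \<in> sets N'}"
  have E: "indep_sets ?E {1..}" using ind sets by (simp add: indep_vars_def)
  have "indep_sets (\<lambda>k. ?E (Suc k)) UNIV"
  proof (rule indep_setsI)
    show "?E (Suc k) \<subseteq> events" for k using E by (auto simp: indep_sets_def)
    fix A :: "nat \<Rightarrow> 'a set" and J :: "nat set"
    assume J: "J \<noteq> {}" "J \<subseteq> UNIV" "finite J" and A: "\<forall>j\<in>J. A j \<in> ?E (Suc j)"
    have "prob (\<Inter>j\<in>Suc ` J. A (j - 1)) = (\<Prod>j\<in>Suc ` J. prob (A (j - 1)))"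
      using J A by (intro indep_setsD[OF E]) auto
    then show "prob (\<Inter>j\<in>J. A j) = (\<Prod>j\<in>J. prob (A j))"
      by (simp add: prod.reindex)
  qed
  with rv show ?thesis by (simp add: indep_vars_def)
qed

theorem theorem5:
  fixes Q :: "(real^'q::finite) set"
    and Pz :: "(real^'q) measure"
    and M :: "'b measure"
    and Z :: "nat \<Rightarrow> 'b \<Rightarrow> real^'q"
    and g :: "'n::finite \<Rightarrow> real^'q"
    and a :: "'n \<Rightarrow> real"
    and f :: "real \<Rightarrow> real"
    and \<gamma> :: "nat \<Rightarrow> real"
    and w :: "nat \<Rightarrow> 'b \<Rightarrow> real^'n"
  assumes Q_compact: "compact Q"
    and Pz_borel: "sets Pz = sets borel"
    and Pz_prob: "prob_space Pz"
    and Pz_support: "measure_support Pz \<subseteq> Q"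
    and M_prob: "prob_space M"
    and Z_indep: "prob_space.indep_vars M (\<lambda>_. borel) Z {1..}"
    and Z_distr: "\<And>k. 1 \<le> k \<Longrightarrow> distr M borel (Z k) = Pz"
    and g_distinct: "inj g"
    and a_pos: "\<And>i. 0 < a i"
    and a_sum: "(\<Sum>i\<in>UNIV. a i) = 1"
    and f_incr: "mono_on {0..} f"
    and \<gamma>_nonneg: "\<And>k. 0 \<le> \<gamma> k"
    and \<gamma>_diverges: "filterlim (\<lambda>K. \<Sum>k<K. \<gamma> k) at_top sequentially"
    and \<gamma>_sq_summable: "summable (\<lambda>k. (\<gamma> k)\<^sup>2)"
    and A1_bdd: "\<And>i. bdd_below ((\<lambda>z. radial_cost f z (g i)) ` Q)"
    and A1_lsc: "\<And>i. lower_semicontinuous_on Q (\<lambda>z. radial_cost f z (g i))"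
    and A1_int: "set_integrable Pz Q (\<lambda>z. MAX i. radial_cost f z (g i))"
    and A2: "\<And>i j r. i \<noteq> j \<Longrightarrow>
               {z\<in>Q. radial_cost f z (g i) - radial_cost f z (g j) = r} \<in> null_sets Pz"
    and w_init: "\<And>\<omega> i. \<omega> \<in> space M \<Longrightarrow> w 0 \<omega> $ i = 0"
    and w_step: "\<And>\<omega> k i. \<omega> \<in> space M \<Longrightarrow> 1 \<le> k \<Longrightarrow>
               w k \<omega> $ i =
                 (if is_arg_min (\<lambda>j. f (norm (Z k \<omega> - g j)) - w (k - 1) \<omega> $ j) (\<lambda>_. True) i
                  then w (k - 1) \<omega> $ i + \<gamma> (k - 1) * (a i - 1)
                  else w (k - 1) \<omega> $ i + \<gamma> (k - 1) * a i)"
  shows "AE \<omega> in M. \<exists>w'.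
           (\<lambda>k. w k \<omega>) \<longlonglongrightarrow> w' \<and>
           is_arg_max (partition_objective Pz Q (radial_cost f) g a) (\<lambda>_. True) w' \<and>
           (\<forall>i. measure Pz (voronoi_cell Q (radial_cost f) g w' i) = a i)"
proof -
  interpret P: prob_space Pz by fact
  interpret M: prob_space M by fact
  define c where "c i z = radial_cost f z (g i)" for i z
  have space_P: "space Pz = UNIV" using sets_eq_imp_space_eq[OF Pz_borel] by simp
  have c_meas [measurable]: "c i \<in> borel_measurable Pz" for i
    unfolding c_def measurable_cong_sets[OF Pz_borel refl]
    by (rule borel_measurable_radial_cost[OF f_incr])
  have Q_sets [measurable]: "Q \<in> sets Pz"
    using compact_imp_closed[OF Q_compact] by (simp add: Pz_borel borel_closed)
  \<comment> \<open>\<open>Q\<close> carries all the mass, so costs and cells may be considered on the whole space.\<close>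
  have AE_Q: "AE z in Pz. z \<in> Q"
    using AE_in_measure_support[OF Pz_borel] by (rule AE_mp) (use Pz_support in auto)
  have c_int: "integrable Pz (c i)" for i
  proof -
    obtain L where L: "\<And>z. z \<in> Q \<Longrightarrow> L \<le> c i z"
      using A1_bdd[of i] unfolding bdd_below_def c_def by auto
    show ?thesis
    proof (rule Bochner_Integration.integrable_bound)
      show "integrable Pz (\<lambda>z. \<bar>indicat_real Q z *\<^sub>R (MAX i. c i z)\<bar> + \<bar>L\<bar>)"
        using A1_int unfolding set_integrable_def c_def by simp
      show "AE z in Pz. norm (c i z) \<le> norm (\<bar>indicat_real Q z *\<^sub>R (MAX i. c i z)\<bar> + \<bar>L\<bar>)"
        using AE_Q
      proof (rule AE_mp, intro AE_I2 impI)
        fix z assume z: "z \<in> Q"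
        have "c i z \<le> (MAX i. c i z)" by (intro Max_ge) auto
        then have "\<bar>c i z\<bar> \<le> \<bar>MAX i. c i z\<bar> + \<bar>L\<bar>" using L[OF z] by linarith
        then show "norm (c i z) \<le> norm (\<bar>indicat_real Q z *\<^sub>R (MAX i. c i z)\<bar> + \<bar>L\<bar>)"
          using z by simp
      qed
    qed simp
  qed
  have ties: "AE z in Pz. c i z - c j z \<noteq> r" if "i \<noteq> j" for i j r
    using AE_not_in[OF A2[OF that, of r]] AE_Q by eventually_elim (simp add: c_def)
  interpret D: semidiscrete_dual Pz c "\<chi> i. a i"
    by unfold_locales (use c_int ties a_pos a_sum in auto)
  have objective: "partition_objective Pz Q (radial_cost f) g a v = D.objective v" for v
  proof -
    have "(LINT z:Q|Pz. (MIN i. c i z - v $ i)) = (\<integral>z. (MIN i. c i z - v $ i) \<partial>Pz)"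
      unfolding set_lebesgue_integral_def
      by (rule integral_cong_AE) (use AE_Q in \<open>auto elim!: eventually_mono\<close>)
    then show ?thesis
      by (simp add: partition_objective_def D.objective_def c_def inner_vec_def)
  qed
  have cell: "measure Pz (voronoi_cell Q (radial_cost f) g v i) = P.prob (D.cell v i)" for v i
  proof -
    have "voronoi_cell Q (radial_cost f) g v i = Q \<inter> D.cell v i"
      by (auto simp: voronoi_cell_def D.cell_def space_P c_def)
    also have "P.prob (Q \<inter> D.cell v i) = P.prob (D.cell v i)"
      by (rule P.finite_measure_eq_AE) (use AE_Q in \<open>auto elim!: eventually_mono\<close>)
    finally show ?thesis .
  qed
  have step: "w (Suc k) \<omega> = w k \<omega> + \<gamma> k *\<^sub>R D.direction (w k \<omega>) (Z (Suc k) \<omega>)"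
    if "\<omega> \<in> space M" for k \<omega>
    using w_step[OF that, of "Suc k"]
    by (auto simp: vec_eq_iff D.direction_def D.cell_def space_P c_def radial_cost_def
        is_arg_min_linorder indicator_def)
  have ind: "M.indep_vars (\<lambda>_. Pz) (\<lambda>k. Z (Suc k)) UNIV"
    by (rule M.indep_vars_shift[OF Z_indep]) (simp add: Pz_borel)
  have distr: "distr M Pz (Z (Suc k)) = Pz" for k
    using Z_distr[of "Suc k"] distr_cong[OF refl Pz_borel, of M "Z (Suc k)" "Z (Suc k)"] by simp
  interpret A: stochastic_dual_ascent Pz c "\<chi> i. a i" M "\<lambda>k. Z (Suc k)" \<gamma> w 0
    by unfold_locales
      (use ind distr \<gamma>_nonneg \<gamma>_diverges \<gamma>_sq_summable step w_init in \<open>auto simp: vec_eq_iff\<close>)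
  show ?thesis
    using A.AE_converges_to_maximizer
  proof (rule AE_mp, intro AE_I2 impI)
    fix \<omega> assume "\<exists>v. (\<lambda>k. w k \<omega>) \<longlonglongrightarrow> v \<and> (\<forall>u. D.objective u \<le> D.objective v)"
    then obtain v where v: "(\<lambda>k. w k \<omega>) \<longlonglongrightarrow> v" "\<And>u. D.objective u \<le> D.objective v" by blast
    then show "\<exists>w'. (\<lambda>k. w k \<omega>) \<longlonglongrightarrow> w' \<and>
        is_arg_max (partition_objective Pz Q (radial_cost f) g a) (\<lambda>_. True) w' \<and>
        (\<forall>i. measure Pz (voronoi_cell Q (radial_cost f) g w' i) = a i)"
      using D.prob_cell_maximizer[OF v(2)]
      by (intro exI[of _ v]) (simp add: is_arg_max_linorder objective cell)
  qed
qed

end
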